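(* Let $n\in\{2,3\}$, let $\Omega\subset\mathbb{R}^n$ be a bounded open domain satisfying the cone condition, let $\epsilon>0$, $\tau>0$, and let $\varphi^{k-1}\in H^1(\Omega)$ with $|\varphi^{k-1}|\le 1$ a.e. in $\Omega$. For $s>0$ let $(\varphi^s,\mu^s)\in H^1(\Omega)\times H^1(\Omega)$ be the unique solution of the relaxed time-discrete Cahn--Hilliard system $$(\varphi^s,v)+\tau(\nabla\mu^s,\nabla v)=(\varphi^{k-1},v)\quad\forall v\in H^1(\Omega),$$ $$\epsilon(\nabla\varphi^s,\nabla v)+\epsilon^{-1}(s\lambda(\varphi^s),v)-\epsilon^{-1}(\varphi^{k-1},v)=(\mu^s,v)\quad\forall v\in H^1(\Omega),$$ where $\lambda(\varphi)=\max(0,\varphi-1)+\min(0,\varphi+1)$. Then there exist $C>0$, independent of $s$, and $s_0>0$ such that for all $s\ge s_0$ $$\|\lambda(\varphi^s)\|_{L^1(\Omega)}\le C\,s^{-1}.$$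
   Context: $(\cdot,\cdot)$ denotes the $L^2(\Omega)$ inner product (for scalar or vector valued functions). $H^1(\Omega)=W^{1,2}(\Omega)$ is the usual Sobolev space. $\Omega$ satisfies the cone condition if there is a fixed finite cone such that every $x\in\Omega$ is the vertex of a cone contained in $\Omega$ and congruent to the fixed one. The system is the Moreau--Yosida relaxation (relaxation parameter $s$, regarded as large) of one time step, of size $\tau$, of the Cahn--Hilliard system with double-obstacle free energy. Known facts about it: for each $s$ it has a unique solution, and there is a constant $C>0$ independent of $s$ with $\|\varphi^s\|_{H^1(\Omega)}+s\|\lambda(\varphi^s)\|_{L^2(\Omega)}+\|\mu^s\|_{H^1(\Omega)}\le C$ as $s\to\infty$. The problem data $\Omega,\epsilon,\tau,\varphi^{k-1}$ are fixed; constants may depend on them but not on $s$. *)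

theory Defs
  imports "HOL-Analysis.Analysis"
begin

section \<open>Test functions\<close>

definition partial_deriv :: "'n::finite \<Rightarrow> (real ^ 'n \<Rightarrow> real) \<Rightarrow> real ^ 'n \<Rightarrow> real" where
  "partial_deriv i f x = frechet_derivative f (at x) (axis i 1)"

text \<open>The class \<open>C^k\<close> on the whole space: all partial derivatives up to order \<open>k\<close> are continuous.\<close>

primrec continuously_diff :: "nat \<Rightarrow> (real ^ 'n::finite \<Rightarrow> real) \<Rightarrow> bool" where
  "continuously_diff 0 f \<longleftrightarrow> continuous_on UNIV f"
| "continuously_diff (Suc k) f \<longleftrightarrow>
     (\<forall>x. f differentiable (at x)) \<and> (\<forall>i. continuously_diff k (partial_deriv i f))"

definition test_functions :: "(real ^ 'n::finite) set \<Rightarrow> (real ^ 'n \<Rightarrow> real) set" where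
  "test_functions \<Omega> = {\<eta>. (\<forall>k. continuously_diff k \<eta>) \<and>
     compact (closure {x. \<eta> x \<noteq> 0}) \<and> closure {x. \<eta> x \<noteq> 0} \<subseteq> \<Omega>}"

section \<open>Lebesgue and Sobolev spaces\<close>

text \<open>
  Elements of the function spaces are represented by functions on the whole space of which only
  the values on \<open>\<Omega>\<close> matter; functions that agree almost everywhere on \<open>\<Omega>\<close> are not identified.
\<close>

definition L2 :: "(real ^ 'n::finite) set \<Rightarrow> (real ^ 'n \<Rightarrow> 'b::euclidean_space) set" where
  "L2 \<Omega> = {f \<in> borel_measurable (lebesgue_on \<Omega>).
     integrable (lebesgue_on \<Omega>) (\<lambda>x. (norm (f x))\<^sup>2)}"

definition L2_inner ::
    "(real ^ 'n::finite) set \<Rightarrow> (real ^ 'n \<Rightarrow> 'b::euclidean_space) \<Rightarrow> (real ^ 'n \<Rightarrow> 'b) \<Rightarrow> real" where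
  "L2_inner \<Omega> f g = (\<integral>x. f x \<bullet> g x \<partial>lebesgue_on \<Omega>)"

text \<open>
  Meaningful only for integrable \<open>f\<close>, since the Bochner integral of a non-integrable function is
  \<open>0\<close>. If \<open>\<Omega>\<close> is bounded and measurable, every \<open>f \<in> L2 \<Omega>\<close> is integrable on \<open>\<Omega>\<close>.
\<close>

definition L1_norm :: "(real ^ 'n::finite) set \<Rightarrow> (real ^ 'n \<Rightarrow> real) \<Rightarrow> real" where
  "L1_norm \<Omega> f = (\<integral>x. \<bar>f x\<bar> \<partial>lebesgue_on \<Omega>)"

definition is_weak_gradient ::
    "(real ^ 'n::finite) set \<Rightarrow> (real ^ 'n \<Rightarrow> real) \<Rightarrow> (real ^ 'n \<Rightarrow> real ^ 'n) \<Rightarrow> bool" where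
  "is_weak_gradient \<Omega> u G \<longleftrightarrow>
     (\<forall>\<eta> \<in> test_functions \<Omega>. \<forall>i.
        (\<integral>x. u x * partial_deriv i \<eta> x \<partial>lebesgue_on \<Omega>) = - (\<integral>x. G x $ i * \<eta> x \<partial>lebesgue_on \<Omega>))"

definition H1 :: "(real ^ 'n::finite) set \<Rightarrow> (real ^ 'n \<Rightarrow> real) set" where
  "H1 \<Omega> = {u \<in> L2 \<Omega>. \<exists>G \<in> L2 \<Omega>. is_weak_gradient \<Omega> u G}"

text \<open>
  For \<open>u \<in> H1 \<Omega>\<close> the weak gradient is unique up to null sets, so the choice does not affect any
  integral in which it occurs.
\<close>

definition weak_gradient ::
    "(real ^ 'n::finite) set \<Rightarrow> (real ^ 'n \<Rightarrow> real) \<Rightarrow> real ^ 'n \<Rightarrow> real ^ 'n" where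
  "weak_gradient \<Omega> u = (SOME G. G \<in> L2 \<Omega> \<and> is_weak_gradient \<Omega> u G)"

section \<open>Cone condition\<close>

definition vec_angle :: "real ^ 'n::finite \<Rightarrow> real ^ 'n \<Rightarrow> real" where
  "vec_angle x y = arccos (x \<bullet> y / (norm x * norm y))"

text \<open>Finite cone with vertex \<open>0\<close>, axis direction \<open>v\<close>, height \<open>\<rho>\<close> and aperture angle \<open>\<kappa>\<close>.\<close>

definition finite_cone :: "real ^ 'n::finite \<Rightarrow> real \<Rightarrow> real \<Rightarrow> (real ^ 'n) set" where
  "finite_cone v \<rho> \<kappa> = {y. y = 0 \<or> (norm y \<le> \<rho> \<and> vec_angle y v \<le> \<kappa> / 2)}"

text \<open>
  The cones congruent to a given cone with vertex \<open>0\<close> and having vertex \<open>x\<close> are its images under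
  \<open>y \<mapsto> x + R y\<close> with \<open>R\<close> orthogonal.
\<close>

definition cone_condition :: "(real ^ 'n::finite) set \<Rightarrow> bool" where
  "cone_condition \<Omega> \<longleftrightarrow>
     (\<exists>(v :: real ^ 'n) \<rho> \<kappa>. v \<noteq> 0 \<and> 0 < \<rho> \<and> 0 < \<kappa> \<and> \<kappa> \<le> pi \<and>
        (\<forall>x \<in> \<Omega>. \<exists>R. orthogonal_transformation R \<and>
           (\<lambda>y. x + R y) ` finite_cone v \<rho> \<kappa> \<subseteq> \<Omega>))"

section \<open>The relaxed time-discrete Cahn--Hilliard system\<close>

definition lam :: "real \<Rightarrow> real" where
  "lam p = max 0 (p - 1) + min 0 (p + 1)"

definition relaxed_CH_solution ::
    "(real ^ 'n::finite) set \<Rightarrow> real \<Rightarrow> real \<Rightarrow> (real ^ 'n \<Rightarrow> real) \<Rightarrow> real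
      \<Rightarrow> (real ^ 'n \<Rightarrow> real) \<Rightarrow> (real ^ 'n \<Rightarrow> real) \<Rightarrow> bool" where
  "relaxed_CH_solution \<Omega> \<epsilon> \<tau> \<phi>prev s \<phi> \<mu> \<longleftrightarrow>
     \<phi> \<in> H1 \<Omega> \<and> \<mu> \<in> H1 \<Omega> \<and>
     (\<forall>v \<in> H1 \<Omega>.
        L2_inner \<Omega> \<phi> v + \<tau> * L2_inner \<Omega> (weak_gradient \<Omega> \<mu>) (weak_gradient \<Omega> v)
          = L2_inner \<Omega> \<phi>prev v) \<and>
     (\<forall>v \<in> H1 \<Omega>.
        \<epsilon> * L2_inner \<Omega> (weak_gradient \<Omega> \<phi>) (weak_gradient \<Omega> v)
          + inverse \<epsilon> * L2_inner \<Omega> (\<lambda>x. s * lam (\<phi> x)) v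
          - inverse \<epsilon> * L2_inner \<Omega> \<phi>prev v
          = L2_inner \<Omega> \<mu> v)"

end

theory Submission
  imports Defs
begin

text \<open>
  Write \<open>P, Q, R\<close> for the weak gradients of \<open>\<phi>, \<mu>, \<phi>prev\<close>, and \<open>\<lambda>\<close> for \<open>lam \<circ> \<phi>\<close>. The function
  \<open>lam\<close> vanishes on \<open>[-1, 1]\<close> and has the sign of its argument, so \<open>\<lambda> (\<phi> - q)\<close> is nonnegative
  whenever \<open>\<bar>q\<bar> \<le> 1\<close>, and it dominates \<open>(1 - \<bar>q\<bar>) \<bar>\<lambda>\<bar>\<close>. The \<open>L\<^sup>1\<close> bound therefore follows from
  two choices of \<open>q\<close> in the test function \<open>\<phi> - q\<close> of the second equation.

  The choice \<open>q = \<phi>prev\<close> is natural because the first equation turns \<open>(\<mu>, \<phi> - \<phi>prev)\<close> into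
  \<open>- \<tau> (Q, Q)\<close>. All remaining terms are gradients, and the result is a bound on \<open>(Q, Q)\<close> and on
  \<open>s (\<lambda>, \<phi> - \<phi>prev)\<close> by a multiple of \<open>(R, R)\<close> (\<open>energy_estimate\<close>). This does not yet control
  \<open>\<lambda>\<close> where \<open>\<phi>prev\<close> is close to \<open>1\<close> or \<open>-1\<close>.

  The choice \<open>q = m\<close>, the mean of \<open>\<phi>prev\<close>, gives \<open>s (1 - \<bar>m\<bar>)\<close> times the \<open>L\<^sup>1\<close> norm of \<open>\<lambda>\<close>. The
  only term on the other side that has no obvious bound is \<open>(\<mu>, \<phi>prev - m)\<close>. As \<open>\<phi>prev - m\<close> has
  mean zero, \<open>\<mu>\<close> may be replaced by \<open>\<mu> - c\<close>, and a Poincare inequality bounds the \<open>L\<^sup>1\<close> norm of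
  \<open>\<mu> - c\<close> by the norm of \<open>Q\<close> (\<open>L1_bound_interior_mean\<close>). If \<open>\<bar>m\<bar> = 1\<close>, then \<open>\<phi>prev\<close> is constant,
  \<open>R = 0\<close>, and the energy estimate already forces \<open>\<lambda> = 0\<close>.

  The analytic core is thus the Poincare inequality in \<open>L\<^sup>1\<close> on a bounded connected domain with the
  cone condition (\<open>poincare_cone_domain\<close>). It rests on a single estimate: if the segments from the
  points of an open set \<open>A\<close> to their translates by \<open>z\<close> stay in \<open>\<Omega>\<close>, then the integral of
  \<open>\<bar>u (z + x) - u x\<bar>\<close> over \<open>A\<close> is at most \<open>\<bar>z\<bar>\<close> times the \<open>L\<^sup>1\<close> norm of the gradient
  (\<open>translation_estimate\<close>). Averaging over all \<open>z\<close> proves the inequality on a ball; translating small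
  balls and using connectedness carries it to compact subsets of \<open>\<Omega>\<close>; and the cone condition
  provides finitely many vectors, one of which moves any given point of \<open>\<Omega>\<close> along a segment in \<open>\<Omega>\<close>
  to a point at a fixed distance from the boundary.

  The translation estimate is proved by duality against test functions, which also shows that
  weak gradients are unique up to null sets.
\<close>

section \<open>Smooth functions and bumps\<close>

definition smooth :: "(real ^ 'n::finite \<Rightarrow> real) \<Rightarrow> bool" where
  "smooth f \<longleftrightarrow> (\<forall>k. continuously_diff k f)"

lemma partial_deriv_eq:
  assumes "(f has_derivative f') (at x)"
  shows "partial_deriv i f x = f' (axis i 1)"
  unfolding partial_deriv_def using frechet_derivative_at[OF assms] by simp

lemma continuously_diff_Suc_imp: "continuously_diff (Suc k) f \<Longrightarrow> continuously_diff k f"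
proof (induction k arbitrary: f)
  case 0
  then show ?case
    by (auto intro!: continuous_at_imp_continuous_on differentiable_imp_continuous_within)
next
  case (Suc k)
  have d: "\<forall>x. f differentiable (at x)" and p: "\<And>i. continuously_diff (Suc k) (partial_deriv i f)"
    using Suc.prems by (auto simp del: continuously_diff.simps simp: continuously_diff.simps(2)[of "Suc k" f])
  show ?case
    using d Suc.IH[OF p] by simp
qed

lemma smoothD:
  assumes "smooth f"
  shows smooth_imp_continuous: "continuous_on S f"
    and smooth_imp_differentiable: "f differentiable (at x)"
    and smooth_partial_deriv: "smooth (partial_deriv i f)"
proof -
  have "continuously_diff 0 f" "continuously_diff (Suc 0) f"
    using assms unfolding smooth_def by blast+
  then show "continuous_on S f" "f differentiable (at x)"
    by (auto intro: continuous_on_subset)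
  have "continuously_diff (Suc k) f" for k
    using assms unfolding smooth_def by blast
  then show "smooth (partial_deriv i f)"
    unfolding smooth_def by auto
qed

text \<open>
  A class of differentiable functions that is closed under partial derivatives consists of smooth
  functions; this replaces an induction on the order for every class whose derivatives have a closed
  form.
\<close>

lemma smooth_coinduct:
  assumes "P f"
    and "\<And>f x. P f \<Longrightarrow> f differentiable (at x)"
    and "\<And>f i. P f \<Longrightarrow> P (partial_deriv i f)"
  shows "smooth f"
proof -
  have "continuously_diff k f" if "P f" for k f
    using that
  proof (induction k arbitrary: f)
    case 0
    then show ?case
      using assms(2) by (auto intro!: continuous_at_imp_continuous_on differentiable_imp_continuous_within)
  next
    case (Suc k)
    then show ?case using assms(2,3) by auto
  qed
  then show ?thesis using assms(1) unfolding smooth_def by blast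
qed

lemma smooth_has_derivative:
  assumes "smooth f"
  shows "(f has_derivative (\<lambda>h. \<Sum>i\<in>UNIV. h $ i * partial_deriv i f x)) (at x)"
proof -
  have d: "(f has_derivative frechet_derivative f (at x)) (at x)"
    using smooth_imp_differentiable[OF assms] frechet_derivative_works by blast
  interpret bounded_linear "frechet_derivative f (at x)"
    using d by (rule has_derivative_bounded_linear)
  have "frechet_derivative f (at x) h = (\<Sum>i\<in>UNIV. h $ i * partial_deriv i f x)" for h
  proof -
    have "frechet_derivative f (at x) h = frechet_derivative f (at x) (\<Sum>i\<in>UNIV. h $ i *s axis i 1)"
      by (simp add: basis_expansion)
    also have "\<dots> = (\<Sum>i\<in>UNIV. h $ i * partial_deriv i f x)"
      by (simp add: sum scaleR partial_deriv_def scalar_mult_eq_scaleR)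
    finally show ?thesis .
  qed
  then have "frechet_derivative f (at x) = (\<lambda>h. \<Sum>i\<in>UNIV. h $ i * partial_deriv i f x)"
    by blast
  then show ?thesis using d by simp
qed

lemma smooth_const: "smooth (\<lambda>x. c)"
proof (rule smooth_coinduct[where P = "\<lambda>f. \<exists>c. f = (\<lambda>x. c)"])
  fix f :: "real ^ 'n \<Rightarrow> real" and i assume "\<exists>c. f = (\<lambda>x. c)"
  then have "partial_deriv i f = (\<lambda>x. 0)"
    by (auto simp: partial_deriv_def)
  then show "\<exists>c. partial_deriv i f = (\<lambda>x. c)" by blast
qed auto

lemma partial_deriv_add:
  assumes "f differentiable (at x)" "g differentiable (at x)"
  shows "partial_deriv i (\<lambda>x. f x + g x) x = partial_deriv i f x + partial_deriv i g x"
proof -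
  have "(f has_derivative frechet_derivative f (at x)) (at x)"
    "(g has_derivative frechet_derivative g (at x)) (at x)"
    using assms frechet_derivative_works by blast+
  from partial_deriv_eq[OF has_derivative_add[OF this]] show ?thesis
    by (simp add: partial_deriv_def)
qed

lemma partial_deriv_mult:
  assumes "f differentiable (at x)" "g differentiable (at x)"
  shows "partial_deriv i (\<lambda>x. f x * g x) x = f x * partial_deriv i g x + partial_deriv i f x * g x"
proof -
  have "(f has_derivative frechet_derivative f (at x)) (at x)"
    "(g has_derivative frechet_derivative g (at x)) (at x)"
    using assms frechet_derivative_works by blast+
  from partial_deriv_eq[OF has_derivative_mult[OF this]] show ?thesis
    by (simp add: partial_deriv_def)
qed

lemma continuously_diff_add:
  assumes "continuously_diff k f" "continuously_diff k g"
  shows "continuously_diff k (\<lambda>x. f x + g x)"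
  using assms
proof (induction k arbitrary: f g)
  case 0
  then show ?case by (auto intro: continuous_intros)
next
  case (Suc k)
  then have "partial_deriv i (\<lambda>x. f x + g x) = (\<lambda>x. partial_deriv i f x + partial_deriv i g x)" for i
    by (auto intro!: partial_deriv_add)
  then show ?case using Suc by auto
qed

lemma continuously_diff_mult:
  assumes "continuously_diff k f" "continuously_diff k g"
  shows "continuously_diff k (\<lambda>x. f x * g x)"
  using assms
proof (induction k arbitrary: f g)
  case 0
  then show ?case by (auto intro: continuous_intros)
next
  case (Suc k)
  then have p: "partial_deriv i (\<lambda>x. f x * g x)
      = (\<lambda>x. f x * partial_deriv i g x + partial_deriv i f x * g x)" for i
    by (auto intro!: partial_deriv_mult)
  have "continuously_diff k f" "continuously_diff k g"
    using Suc.prems by (blast intro: continuously_diff_Suc_imp)+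
  then show ?case using Suc unfolding continuously_diff.simps p
    by (auto intro!: continuously_diff_add)
qed

lemma smooth_add: "smooth f \<Longrightarrow> smooth g \<Longrightarrow> smooth (\<lambda>x. f x + g x)"
  unfolding smooth_def using continuously_diff_add by blast

lemma smooth_mult: "smooth f \<Longrightarrow> smooth g \<Longrightarrow> smooth (\<lambda>x. f x * g x)"
  unfolding smooth_def using continuously_diff_mult by blast

lemma smooth_cmult: "smooth f \<Longrightarrow> smooth (\<lambda>x. c * f x)"
  by (intro smooth_mult smooth_const)

lemma smooth_diff: "smooth f \<Longrightarrow> smooth g \<Longrightarrow> smooth (\<lambda>x. f x - g x)"
  using smooth_add[of f "\<lambda>x. -1 * g x"] smooth_cmult[of g "-1"] by simp

lemma smooth_power: "smooth f \<Longrightarrow> smooth (\<lambda>x. f x ^ n)"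
  by (induction n) (auto intro: smooth_mult smooth_const)

lemma smooth_prod: "(\<And>k. k \<in> K \<Longrightarrow> smooth (f k)) \<Longrightarrow> smooth (\<lambda>x. \<Prod>k\<in>K. f k x)"
  by (induction K rule: infinite_finite_induct) (auto intro: smooth_mult smooth_const)

lemma smooth_bounded_linear:
  fixes f :: "real ^ 'n::finite \<Rightarrow> real"
  assumes "bounded_linear f" shows "smooth f"
proof -
  have d: "(f has_derivative f) (at x)" for x
    using assms by (rule bounded_linear_imp_has_derivative)
  have "partial_deriv i f = (\<lambda>x. f (axis i 1))" for i
    using partial_deriv_eq[OF d] by blast
  then have "smooth (partial_deriv i f)" for i by (simp add: smooth_const)
  moreover have "f differentiable (at x)" for x using d differentiable_def by blast
  moreover have "continuous_on UNIV f" by (simp add: assms linear_continuous_on)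
  ultimately have "continuously_diff k f" for k
    by (cases k) (auto simp: smooth_def)
  then show ?thesis by (simp add: smooth_def)
qed

lemma smooth_real_polynomial_function:
  fixes f :: "real ^ 'n::finite \<Rightarrow> real"
  shows "real_polynomial_function f \<Longrightarrow> smooth f"
  by (induction rule: real_polynomial_function.induct)
    (auto intro: smooth_bounded_linear smooth_const smooth_add smooth_mult)

lemma has_derivative_translate:
  fixes f :: "'a::real_normed_vector \<Rightarrow> 'b::real_normed_vector"
  assumes "(f has_derivative f') (at (x - a))"
  shows "((\<lambda>x. f (x - a)) has_derivative f') (at x)"
proof -
  have "((\<lambda>x. x - a) has_derivative (\<lambda>h. h)) (at x)"
    by (auto intro!: derivative_eq_intros)
  from has_derivative_compose[OF this assms] show ?thesis .
qed

lemma partial_deriv_translate: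
  assumes "smooth f"
  shows "partial_deriv i (\<lambda>x. f (x - a)) x = partial_deriv i f (x - a)"
proof -
  have "(f has_derivative frechet_derivative f (at (x - a))) (at (x - a))"
    using smooth_imp_differentiable[OF assms] frechet_derivative_works by blast
  note has_derivative_translate[OF this]
  from partial_deriv_eq[OF this] show ?thesis by (simp add: partial_deriv_def)
qed

lemma smooth_translate:
  fixes f :: "real ^ 'n::finite \<Rightarrow> real"
  assumes "smooth f" shows "smooth (\<lambda>x. f (x - a))"
proof (rule smooth_coinduct[where P = "\<lambda>h. \<exists>f. smooth f \<and> h = (\<lambda>x. f (x - a))"])
  fix h :: "real ^ 'n \<Rightarrow> real" and x
  assume "\<exists>f. smooth f \<and> h = (\<lambda>x. f (x - a))"
  then obtain f where f: "smooth f" and h: "h = (\<lambda>x. f (x - a))" by blast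
  have "f differentiable (at (x - a))" using f by (rule smooth_imp_differentiable)
  then show "h differentiable (at x)"
    unfolding h differentiable_def by (blast intro: has_derivative_translate)
next
  fix h :: "real ^ 'n \<Rightarrow> real" and i
  assume "\<exists>f. smooth f \<and> h = (\<lambda>x. f (x - a))"
  then obtain f where f: "smooth f" and h: "h = (\<lambda>x. f (x - a))" by blast
  have "partial_deriv i h = (\<lambda>x. partial_deriv i f (x - a))"
    unfolding h using partial_deriv_translate[OF f] by blast
  then show "\<exists>f. smooth f \<and> partial_deriv i h = (\<lambda>x. f (x - a))"
    using f smooth_partial_deriv by blast
qed (use assms in auto)

text \<open>
  A sequence \<open>H\<close> in which each function is the derivative of the previous one avoids iterated
  derivatives of functions of one variable.
\<close>

lemma smooth_coordinate_chain:
  fixes H :: "nat \<Rightarrow> real \<Rightarrow> real"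
  assumes H: "\<And>m t. (H m has_real_derivative H (Suc m) t) (at t)"
  shows "smooth (\<lambda>x :: real ^ 'n::finite. H m (c * x $ j + d))"
proof (rule smooth_coinduct[where P = "\<lambda>f. \<exists>m b. f = (\<lambda>x. b * H m (c * x $ j + d))"])
  have der: "((\<lambda>x :: real ^ 'n. b * H m (c * x $ j + d)) has_derivative
      (\<lambda>h. b * (H (Suc m) (c * x $ j + d) * (c * h $ j)))) (at x)" for m b x
  proof -
    have "((\<lambda>x :: real ^ 'n. c * x $ j + d) has_derivative (\<lambda>h. c * h $ j)) (at x)"
      by (auto intro!: derivative_eq_intros bounded_linear_imp_has_derivative bounded_linear_vec_nth)
    from DERIV_compose_FDERIV[OF H this] have
      "((\<lambda>x. H m (c * x $ j + d)) has_derivative (\<lambda>h. c * h $ j * H (Suc m) (c * x $ j + d))) (at x)" .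
    from has_derivative_mult_right[OF this, of b] show ?thesis by (simp add: ac_simps)
  qed
  show "\<exists>m' b. (\<lambda>x :: real ^ 'n. H m (c * x $ j + d)) = (\<lambda>x. b * H m' (c * x $ j + d))"
    by (rule exI[of _ m], rule exI[of _ 1]) simp
  fix f :: "real ^ 'n \<Rightarrow> real"
  assume "\<exists>m b. f = (\<lambda>x. b * H m (c * x $ j + d))"
  then obtain m b where f: "f = (\<lambda>x. b * H m (c * x $ j + d))" by blast
  show "f differentiable (at x)" for x
    using der unfolding f differentiable_def by blast
  have "partial_deriv i f x = (b * c * axis i 1 $ j) * H (Suc m) (c * x $ j + d)" for i x
    unfolding f using partial_deriv_eq[OF der] by (simp add: ac_simps)
  then show "\<exists>m b. partial_deriv i f = (\<lambda>x. b * H m (c * x $ j + d))" for i by blast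
qed

text \<open>
  The family \<open>flat\<close> consists of the derivatives of the function that is \<open>exp (-1/t)\<close> for \<open>t > 0\<close> and
  \<open>0\<close> otherwise. The \<open>m\<close>-th derivative of \<open>exp (-1/t)\<close> is \<open>p\<^sub>m (1/t) exp (-1/t)\<close> with polynomials \<open>p\<^sub>m\<close>.
\<close>

primrec flat_poly :: "nat \<Rightarrow> real poly" where
  "flat_poly 0 = 1"
| "flat_poly (Suc m) = monom 1 2 * (flat_poly m - pderiv (flat_poly m))"

definition flat :: "nat \<Rightarrow> real \<Rightarrow> real" where
  "flat m t = (if t > 0 then poly (flat_poly m) (1 / t) * exp (- (1 / t)) else 0)"

lemma poly_exp_decay: "((\<lambda>y. poly p y * exp (- y)) \<longlongrightarrow> 0) at_top" for p :: "real poly"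
proof -
  have "((\<lambda>y. \<Sum>i\<le>degree p. coeff p i * (y ^ i / exp y)) \<longlongrightarrow> (\<Sum>i\<le>degree p. coeff p i * 0)) at_top"
    by (intro tendsto_sum tendsto_mult tendsto_const tendsto_power_div_exp_0)
  then show ?thesis
    by (simp add: poly_altdef sum_distrib_right exp_minus divide_inverse mult.assoc)
qed

text \<open>
  At \<open>t = 0\<close> the right difference quotient is again a polynomial in \<open>1/t\<close> times \<open>exp (-1/t)\<close>, and
  exponential decay beats the polynomial.
\<close>

lemma flat_has_derivative: "(flat m has_real_derivative flat (Suc m) t) (at t)"
proof -
  consider "t > 0" | "t < 0" | "t = 0" by linarith
  then show ?thesis
  proof cases
    case 1
    have "((\<lambda>t. poly (flat_poly m) (1 / t) * exp (- (1 / t))) has_real_derivative flat (Suc m) t) (at t)"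
      using 1 by (auto intro!: derivative_eq_intros DERIV_chain2[OF poly_DERIV]
          simp: flat_def poly_monom field_simps power2_eq_square)
    then show ?thesis
      by (rule has_field_derivative_transform_within_open[where S = "{0<..}"])
        (use 1 in \<open>auto simp: flat_def\<close>)
  next
    case 2
    have "((\<lambda>t. 0) has_real_derivative flat (Suc m) t) (at t)"
      using 2 by (auto simp: flat_def)
    then show ?thesis
      by (rule has_field_derivative_transform_within_open[where S = "{..<0}"])
        (use 2 in \<open>auto simp: flat_def\<close>)
  next
    case 3
    have "((\<lambda>h. poly (monom 1 1 * flat_poly m) (1 / h) * exp (- (1 / h))) \<longlongrightarrow> 0) (at_right 0)"
      by (rule filterlim_compose[OF poly_exp_decay])
        (simp add: filterlim_inverse_at_top_right divide_inverse)
    then have r: "((\<lambda>h. (flat m (0 + h) - flat m 0) / h) \<longlongrightarrow> 0) (at_right 0)"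
      by (rule Lim_transform_eventually)
        (auto simp: eventually_at_right_less flat_def poly_monom field_simps
          intro!: eventually_at_rightI[of 0 1])
    have l: "((\<lambda>h. (flat m (0 + h) - flat m 0) / h) \<longlongrightarrow> 0) (at_left 0)"
      by (rule Lim_transform_eventually[OF tendsto_const])
        (auto simp: flat_def intro!: eventually_at_leftI[of "-1"])
    have "((\<lambda>h. (flat m (0 + h) - flat m 0) / h) \<longlongrightarrow> 0) (at 0)"
      using l r filterlim_split_at by blast
    then show ?thesis using 3 by (simp add: DERIV_def flat_def)
  qed
qed

text \<open>
  The factors \<open>1\<close> and \<open>-1\<close> and the sums with \<open>- a $ i\<close> and \<open>b $ i\<close> give each coordinate the form
  \<open>c * x $ j + d\<close> of \<open>smooth_coordinate_chain\<close>.
\<close>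

definition bump :: "real ^ 'n::finite \<Rightarrow> real ^ 'n \<Rightarrow> real ^ 'n \<Rightarrow> real" where
  "bump a b x = (\<Prod>i\<in>UNIV. flat 0 (1 * x $ i + - a $ i) * flat 0 (-1 * x $ i + b $ i))"

lemma flat_0: "0 \<le> flat 0 t" "flat 0 t \<le> 1" "flat 0 t > 0 \<longleftrightarrow> t > 0"
  by (auto simp: flat_def)

lemma smooth_bump: "smooth (bump a b)"
  unfolding bump_def[abs_def]
  by (intro smooth_prod smooth_mult smooth_coordinate_chain flat_has_derivative)

lemma bump_bounds: "0 \<le> bump a b x" "bump a b x \<le> 1"
proof -
  show "0 \<le> bump a b x"
    unfolding bump_def by (intro prod_nonneg ballI mult_nonneg_nonneg flat_0)
  show "bump a b x \<le> 1"
    unfolding bump_def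
    by (intro prod_le_1 conjI mult_nonneg_nonneg mult_le_one flat_0)
qed

lemma bump_nonzero_iff: "bump a b x \<noteq> 0 \<longleftrightarrow> x \<in> box a b"
proof -
  have "bump a b x \<noteq> 0 \<longleftrightarrow> (\<forall>i. flat 0 (1 * x $ i + - a $ i) \<noteq> 0 \<and> flat 0 (-1 * x $ i + b $ i) \<noteq> 0)"
    by (simp add: bump_def)
  also have "\<dots> \<longleftrightarrow> (\<forall>i. a $ i < x $ i \<and> x $ i < b $ i)"
    by (auto simp: flat_def)
  finally show ?thesis by (simp add: mem_box_cart)
qed

section \<open>Test functions and duality\<close>

lemma test_functionI:
  assumes "smooth \<eta>" "compact K" "K \<subseteq> \<Omega>" "\<And>x. x \<notin> K \<Longrightarrow> \<eta> x = 0"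
  shows "\<eta> \<in> test_functions \<Omega>"
proof -
  have "closure {x. \<eta> x \<noteq> 0} \<subseteq> K"
    using assms(2,4) by (intro closure_minimal) (auto intro: compact_imp_closed)
  moreover from this have "compact (closure {x. \<eta> x \<noteq> 0})"
    using assms(2) by (metis closed_closure compact_Int_closed inf.absorb_iff2)
  ultimately show ?thesis
    using assms(1,3) unfolding test_functions_def smooth_def by auto
qed

lemma test_functionD:
  assumes "\<eta> \<in> test_functions \<Omega>"
  shows test_function_smooth: "smooth \<eta>"
    and test_function_support: "\<exists>K. compact K \<and> K \<subseteq> \<Omega> \<and> (\<forall>x. x \<notin> K \<longrightarrow> \<eta> x = 0)"
proof -
  show "smooth \<eta>" using assms by (simp add: test_functions_def smooth_def)
  show "\<exists>K. compact K \<and> K \<subseteq> \<Omega> \<and> (\<forall>x. x \<notin> K \<longrightarrow> \<eta> x = 0)"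
    by (rule exI[of _ "closure {x. \<eta> x \<noteq> 0}"])
      (use assms closure_subset[of "{x. \<eta> x \<noteq> 0}"] in \<open>auto simp: test_functions_def\<close>)
qed

text \<open>
  Countably many open boxes, each with its closure in \<open>A\<close>, cover \<open>A\<close>. Let \<open>b\<^sub>k\<close> be bumps on them
  and consider \<open>1 - \<Prod>\<^sub>k\<^sub><\<^sub>n (1 - b\<^sub>k)\<^sup>n\<close>. Its support lies in finitely many of the boxes. A point of
  \<open>A\<close> makes one of the factors \<open>1 - b\<^sub>k\<close> smaller than \<open>1\<close>, and the exponent \<open>n\<close> drives the product
  to \<open>0\<close> there.
\<close>

lemma cutoff_sequence:
  fixes A :: "(real ^ 'n::finite) set"
  assumes "open A"
  obtains \<psi> where "\<And>n::nat. \<psi> n \<in> test_functions A" "\<And>n x. 0 \<le> \<psi> n x" "\<And>n x. \<psi> n x \<le> 1"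
    "\<And>x. x \<in> A \<Longrightarrow> (\<lambda>n. \<psi> n x) \<longlonglongrightarrow> 1"
proof -
  define F where "F = {box a b |a b :: real ^ 'n. cbox a b \<subseteq> A}"
  obtain F' where F': "F' \<subseteq> F" "countable F'" "\<Union>F' = \<Union>F"
    by (rule Lindelof[of F]) (auto simp: F_def)
  have "\<exists>a b. x \<in> box a b \<and> cbox a b \<subseteq> A" if "x \<in> A" for x
    using open_contains_cbox[of A x] assms that by metis
  then have "A \<subseteq> \<Union>F" unfolding F_def by blast
  then have cov: "A \<subseteq> \<Union>(insert {} F')" using F'(3) by auto
  have "\<exists>a b. from_nat_into (insert {} F') k = box a b \<and> cbox a b \<subseteq> A" for k
  proof -
    have "from_nat_into (insert {} F') k \<in> insert {} F'" by (rule from_nat_into) simp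
    moreover have "box 1 (0 :: real ^ 'n) = {} \<and> cbox 1 (0 :: real ^ 'n) = {}"
      by (auto simp: mem_box_cart) (meson not_one_less_zero less_trans, meson not_one_le_zero order_trans)
    ultimately show ?thesis using F'(1) unfolding F_def by blast
  qed
  then obtain a b where ab: "\<And>k. from_nat_into (insert {} F') k = box (a k) (b k)"
    "\<And>k. cbox (a k) (b k) \<subseteq> A" by metis
  define \<psi> where "\<psi> n x = 1 - (\<Prod>k<n. (1 - bump (a k) (b k) x) ^ n)" for n :: nat and x
  have f: "0 \<le> (1 - bump (a k) (b k) x) ^ n" "(1 - bump (a k) (b k) x) ^ n \<le> 1" for k n x
    using bump_bounds[of "a k" "b k" x] by (auto intro: power_le_one)
  show thesis
  proof
    fix n
    show "\<psi> n \<in> test_functions A"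
    proof (rule test_functionI[where K = "\<Union>k<n. cbox (a k) (b k)"])
      show "smooth (\<psi> n)"
        unfolding \<psi>_def[abs_def]
        by (intro smooth_diff smooth_prod smooth_power smooth_const smooth_bump)
      show "compact (\<Union>k<n. cbox (a k) (b k))" by (intro compact_UN) auto
      show "(\<Union>k<n. cbox (a k) (b k)) \<subseteq> A" using ab(2) by blast
      fix x assume x: "x \<notin> (\<Union>k<n. cbox (a k) (b k))"
      have "bump (a k) (b k) x = 0" if "k < n" for k
        using x that bump_nonzero_iff[of "a k" "b k" x] box_subset_cbox[of "a k" "b k"] by blast
      then show "\<psi> n x = 0" by (simp add: \<psi>_def)
    qed
  next
    fix n x
    show "0 \<le> \<psi> n x" "\<psi> n x \<le> 1"
      unfolding \<psi>_def using f by (auto intro: prod_le_1 prod_nonneg)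
  next
    fix x assume "x \<in> A"
    then obtain B where "B \<in> insert {} F'" "x \<in> B" using cov by blast
    moreover have "countable (insert {} F')" using F'(2) by simp
    ultimately obtain j where j: "x \<in> box (a j) (b j)"
      using ab(1) from_nat_into_surj by metis
    define q where "q = 1 - bump (a j) (b j) x"
    have "bump (a j) (b j) x \<noteq> 0" using j bump_nonzero_iff by blast
    then have q: "0 \<le> q" "q < 1"
      using bump_bounds[of "a j" "b j" x] unfolding q_def by linarith+
    have le: "(\<Prod>k<n. (1 - bump (a k) (b k) x) ^ n) \<le> q ^ n" if "n > j" for n
    proof -
      have "(\<Prod>k<n. (1 - bump (a k) (b k) x) ^ n)
          = q ^ n * (\<Prod>k\<in>{..<n} - {j}. (1 - bump (a k) (b k) x) ^ n)"
        unfolding q_def using that by (subst prod.remove[of _ j]) auto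
      also have "\<dots> \<le> q ^ n * 1"
        using f q by (intro mult_left_mono prod_le_1) auto
      finally show ?thesis by simp
    qed
    have "(\<lambda>n. \<Prod>k<n. (1 - bump (a k) (b k) x) ^ n) \<longlonglongrightarrow> 0"
    proof (rule tendsto_sandwich[OF _ _ tendsto_const])
      show "(\<lambda>n. q ^ n) \<longlonglongrightarrow> 0" using q by (intro LIMSEQ_power_zero) auto
      show "\<forall>\<^sub>F n in sequentially. 0 \<le> (\<Prod>k<n. (1 - bump (a k) (b k) x) ^ n)"
        using f by (intro always_eventually allI prod_nonneg) auto
      show "\<forall>\<^sub>F n in sequentially. (\<Prod>k<n. (1 - bump (a k) (b k) x) ^ n) \<le> q ^ n"
        using eventually_gt_at_top[of j] by eventually_elim (rule le)
    qed
    from tendsto_diff[OF tendsto_const[of 1] this] show "(\<lambda>n. \<psi> n x) \<longlonglongrightarrow> 1"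
      unfolding \<psi>_def by simp
  qed
qed

lemma test_function_mult:
  assumes "\<eta> \<in> test_functions \<Omega>" "smooth f"
  shows "(\<lambda>x. \<eta> x * f x) \<in> test_functions \<Omega>"
proof -
  obtain K where "compact K" "K \<subseteq> \<Omega>" "\<forall>x. x \<notin> K \<longrightarrow> \<eta> x = 0"
    using test_function_support[OF assms(1)] by blast
  then show ?thesis
    using smooth_mult[OF test_function_smooth[OF assms(1)] assms(2)]
    by (intro test_functionI[of _ K]) auto
qed

text \<open>
  The supremum of \<open>\<integral> f \<eta>\<close> over test functions with values in \<open>[-1, 1]\<close> is the \<open>L\<^sup>1\<close> norm:
  the sign of \<open>f\<close> is an almost everywhere limit of continuous functions, these are uniformly close
  to polynomials, and a cut-off turns polynomials into test functions.
\<close>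

lemma L1_le_by_duality:
  fixes f :: "real ^ 'n::finite \<Rightarrow> real"
  assumes A: "open A" "bounded A" and f: "integrable lborel f"
    and M: "\<And>\<eta>. \<eta> \<in> test_functions A \<Longrightarrow> (\<And>x. \<bar>\<eta> x\<bar> \<le> 1) \<Longrightarrow> (\<integral>x. f x * \<eta> x \<partial>lborel) \<le> M"
  shows "(\<integral>x. indicator A x * \<bar>f x\<bar> \<partial>lborel) \<le> M"
proof -
  have fm[measurable]: "f \<in> borel_measurable borel" using f by auto
  have "(\<lambda>x. sgn (f x)) \<in> borel_measurable lebesgue"
    by (intro measurable_completion) measurable
  then have "(\<lambda>x. sgn (f x)) measurable_on UNIV"
    by (intro lebesgue_measurable_imp_measurable_on_real) auto
  then obtain N g where N: "negligible N" and g: "\<And>n. continuous_on UNIV (g n)"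
    and lim: "\<And>x. x \<notin> N \<Longrightarrow> (\<lambda>n. g n x) \<longlonglongrightarrow> sgn (f x)"
    unfolding measurable_on_def by auto
  \<comment> \<open>Truncation keeps the limit because the sign takes values in \<open>[-1, 1]\<close>.\<close>
  define h where "h n x = max (-1) (min 1 (g n x))" for n :: nat and x
  have h: "\<bar>h n x\<bar> \<le> 1" for n x unfolding h_def by auto
  have hlim: "(\<lambda>n. h n x) \<longlonglongrightarrow> sgn (f x)" if "x \<notin> N" for x
  proof -
    have "(\<lambda>n. h n x) \<longlonglongrightarrow> max (-1) (min 1 (sgn (f x)))"
      unfolding h_def by (intro tendsto_max tendsto_min tendsto_const lim that)
    then show ?thesis by (simp add: sgn_if split: if_splits)
  qed
  have "\<exists>p. real_polynomial_function p \<and> (\<forall>x\<in>closure A. \<bar>h n x - p x\<bar> < 1 / Suc n)" for n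
  proof (rule Stone_Weierstrass_real_polynomial_function[of "closure A" "h n" "1 / Suc n"])
    show "compact (closure A)" using A(2) by simp
    have "continuous_on (closure A) (g n)" using g continuous_on_subset by blast
    then show "continuous_on (closure A) (h n)"
      unfolding h_def by (intro continuous_on_max continuous_on_min continuous_on_const)
  qed auto
  then obtain p where p: "\<And>n. real_polynomial_function (p n)"
    and hp: "\<And>n x. x \<in> closure A \<Longrightarrow> \<bar>h n x - p n x\<bar> < 1 / Suc n" by metis
  obtain \<psi> where \<psi>: "\<And>n::nat. \<psi> n \<in> test_functions A" "\<And>n x. 0 \<le> \<psi> n x" "\<And>n x. \<psi> n x \<le> 1"
    "\<And>x. x \<in> A \<Longrightarrow> (\<lambda>n. \<psi> n x) \<longlonglongrightarrow> 1"
    using cutoff_sequence[OF A(1)] by blast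
  \<comment> \<open>Dividing by \<open>1 + 1/(n+1)\<close> brings the polynomial approximations back into \<open>[-1, 1]\<close>.\<close>
  define \<eta> where "\<eta> n x = \<psi> n x * (inverse (1 + 1 / Suc n) * p n x)" for n x
  have test: "\<eta> n \<in> test_functions A" for n
    unfolding \<eta>_def[abs_def]
    by (intro test_function_mult \<psi> smooth_cmult smooth_real_polynomial_function p)
  have off: "\<eta> n x = 0" if "x \<notin> A" for n x
    using test_function_support[OF \<psi>(1)[of n]] that unfolding \<eta>_def by auto
  have bnd: "\<bar>\<eta> n x\<bar> \<le> 1" for n x
  proof (cases "x \<in> A")
    case True
    then have "\<bar>h n x - p n x\<bar> < 1 / Suc n" using hp closure_subset by blast
    then have "\<bar>p n x\<bar> \<le> 1 + 1 / Suc n" using h[of n x] by linarith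
    moreover have "0 < 1 + 1 / real (Suc n)" by (simp add: add_pos_pos)
    ultimately have "\<bar>inverse (1 + 1 / Suc n) * p n x\<bar> \<le> 1"
      by (simp only: abs_mult abs_inverse abs_of_pos) (simp add: inverse_eq_divide)
    then show ?thesis unfolding \<eta>_def using \<psi>(2,3)[of n x]
      by (simp add: abs_mult[of "\<psi> n x"] mult_le_one)
  qed (simp add: off)
  have elim: "(\<lambda>n. \<eta> n x) \<longlonglongrightarrow> indicator A x * sgn (f x)" if "x \<notin> N" for x
  proof (cases "x \<in> A")
    case True
    have z: "(\<lambda>n. 1 / real (Suc n)) \<longlonglongrightarrow> 0" using LIMSEQ_inverse_real_of_nat by (simp add: inverse_eq_divide)
    have "(\<lambda>n. h n x - p n x) \<longlonglongrightarrow> 0"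
    proof (rule Lim_null_comparison[OF _ z])
      have "x \<in> closure A" using True closure_subset by blast
      then have "norm (h n x - p n x) \<le> 1 / Suc n" for n using hp[of x n] by simp
      then show "\<forall>\<^sub>F n in sequentially. norm (h n x - p n x) \<le> 1 / Suc n" by simp
    qed
    from tendsto_diff[OF hlim[OF that] this] have "(\<lambda>n. p n x) \<longlonglongrightarrow> sgn (f x)" by simp
    moreover have "(\<lambda>n. inverse (1 + 1 / real (Suc n))) \<longlonglongrightarrow> inverse (1 + 0)"
      by (intro tendsto_inverse tendsto_add tendsto_const z) simp
    ultimately have "(\<lambda>n. \<eta> n x) \<longlonglongrightarrow> 1 * (inverse (1 + 0) * sgn (f x))"
      unfolding \<eta>_def by (intro tendsto_mult \<psi>(4)[OF True])
    then show ?thesis using True by simp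
  qed (simp add: off)
  have eq: "f x * (indicator A x * sgn (f x)) = indicator A x * \<bar>f x\<bar>" for x
    by (simp add: abs_sgn mult.left_commute)
  have [measurable]: "A \<in> sets borel" using A(1) by simp
  have "(\<lambda>n. \<integral>x. f x * \<eta> n x \<partial>lborel) \<longlonglongrightarrow> (\<integral>x. f x * (indicator A x * sgn (f x)) \<partial>lborel)"
  proof (rule integral_dominated_convergence[where w = "\<lambda>x. \<bar>f x\<bar>"])
    have "continuous_on UNIV (\<eta> n)" for n
      using test test_function_smooth smooth_imp_continuous by blast
    then show "(\<lambda>x. f x * \<eta> n x) \<in> borel_measurable lborel" for n
      using fm borel_measurable_continuous_onI by (intro borel_measurable_times) auto
    show "(\<lambda>x. f x * (indicator A x * sgn (f x))) \<in> borel_measurable lborel"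
      unfolding eq by measurable
    have "AE x in lebesgue. x \<notin> N"
      using N unfolding negligible_iff_null_sets by (rule AE_not_in)
    then have "AE x in lborel. x \<notin> N" by (simp add: AE_completion_iff)
    then show "AE x in lborel. (\<lambda>n. f x * \<eta> n x) \<longlonglongrightarrow> f x * (indicator A x * sgn (f x))"
      by eventually_elim (intro tendsto_mult tendsto_const elim)
    show "integrable lborel (\<lambda>x. \<bar>f x\<bar>)" using f by simp
    show "AE x in lborel. norm (f x * \<eta> n x) \<le> \<bar>f x\<bar>" for n
      using bnd by (auto simp: abs_mult intro!: mult_left_le)
  qed
  then have "(\<lambda>n. \<integral>x. f x * \<eta> n x \<partial>lborel) \<longlonglongrightarrow> (\<integral>x. indicator A x * \<bar>f x\<bar> \<partial>lborel)"
    by (simp add: eq)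
  then show ?thesis
    by (rule LIMSEQ_le_const2) (use M test bnd in blast)
qed

section \<open>Weak gradients and translations\<close>

lemma integral_lborel_translate:
  fixes f :: "'a::euclidean_space \<Rightarrow> real"
  assumes [measurable]: "f \<in> borel_measurable borel"
  shows "(\<integral>x. f (a + x) \<partial>lborel) = (\<integral>x. f x \<partial>lborel)"
proof -
  have "(\<integral>x. f x \<partial>lborel) = (\<integral>x. f x \<partial>distr lborel borel ((+) a))"
    by (simp add: lborel_distr_plus)
  also have "\<dots> = (\<integral>x. f (a + x) \<partial>lborel)" by (rule integral_distr) measurable
  finally show ?thesis by simp
qed

lemma integrable_lborel_translate:
  fixes f :: "'a::euclidean_space \<Rightarrow> real"
  assumes "integrable lborel f"
  shows "integrable lborel (\<lambda>x. f (a + x))"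
proof -
  have [measurable]: "f \<in> borel_measurable borel" using assms by auto
  have "integrable (distr lborel borel ((+) a)) f" using assms by (simp add: lborel_distr_plus)
  then show ?thesis by (subst (asm) integrable_distr_eq) auto
qed

definition dir_deriv :: "real ^ 'n::finite \<Rightarrow> (real ^ 'n \<Rightarrow> real) \<Rightarrow> real ^ 'n \<Rightarrow> real" where
  "dir_deriv z \<eta> x = (\<Sum>i\<in>UNIV. z $ i * partial_deriv i \<eta> x)"

lemma partial_deriv_outside:
  assumes "open U" "x \<in> U" "\<And>y. y \<in> U \<Longrightarrow> \<eta> y = 0"
  shows "partial_deriv i \<eta> x = 0"
proof -
  have "((\<lambda>y. 0 :: real) has_derivative (\<lambda>h. 0)) (at x)" by simp
  then have "(\<eta> has_derivative (\<lambda>h. 0)) (at x)"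
    using assms(1,2) by (rule has_derivative_transform_within_open) (simp add: assms(3))
  then show ?thesis by (rule partial_deriv_eq[THEN trans]) simp
qed

lemma test_function_partial_deriv:
  assumes "\<eta> \<in> test_functions \<Omega>"
  shows "partial_deriv i \<eta> \<in> test_functions \<Omega>"
proof -
  obtain K where K: "compact K" "K \<subseteq> \<Omega>" "\<And>x. x \<notin> K \<Longrightarrow> \<eta> x = 0"
    using test_function_support[OF assms] by blast
  have "open (- K)" using compact_imp_closed[OF K(1)] by (simp add: open_Compl)
  then have "partial_deriv i \<eta> x = 0" if "x \<notin> K" for x
    using that K(3) by (intro partial_deriv_outside[of "- K"]) auto
  then show ?thesis
    using K by (intro test_functionI[of _ K] smooth_partial_deriv test_function_smooth[OF assms])
qed

lemma test_function_continuous: "\<eta> \<in> test_functions \<Omega> \<Longrightarrow> continuous_on S \<eta>"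
  by (intro smooth_imp_continuous test_function_smooth)

lemma test_function_borel: "\<eta> \<in> test_functions \<Omega> \<Longrightarrow> \<eta> \<in> borel_measurable borel"
  by (intro borel_measurable_continuous_onI test_function_continuous)

lemma test_function_bounded:
  assumes "\<eta> \<in> test_functions \<Omega>"
  shows "\<exists>B. \<forall>x. \<bar>\<eta> x\<bar> \<le> B"
proof -
  obtain K where K: "compact K" "\<forall>x. x \<notin> K \<longrightarrow> \<eta> x = 0"
    using test_function_support[OF assms] by blast
  have "bounded (\<eta> ` K)"
    using compact_continuous_image[OF smooth_imp_continuous[OF test_function_smooth[OF assms]] K(1)]
    by (rule compact_imp_bounded)
  then obtain B where B: "\<And>x. x \<in> K \<Longrightarrow> \<bar>\<eta> x\<bar> \<le> B" unfolding bounded_iff by auto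
  have "\<bar>\<eta> x\<bar> \<le> max B 0" for x using B[of x] K(2) by (cases "x \<in> K") auto
  then show ?thesis by blast
qed

lemma dir_deriv_axis: "dir_deriv (axis i 1) \<eta> = partial_deriv i \<eta>"
proof
  fix x
  have "dir_deriv (axis i 1) \<eta> x = (\<Sum>j\<in>UNIV. if j = i then partial_deriv j \<eta> x else 0)"
    unfolding dir_deriv_def axis_def by (intro sum.cong) auto
  then show "dir_deriv (axis i 1) \<eta> x = partial_deriv i \<eta> x" by simp
qed

lemma dir_deriv_continuous: "\<eta> \<in> test_functions \<Omega> \<Longrightarrow> continuous_on S (dir_deriv z \<eta>)"
  unfolding dir_deriv_def[abs_def]
  by (intro continuous_on_sum continuous_on_mult continuous_on_const
      test_function_continuous test_function_partial_deriv)

lemma dir_deriv_bounded: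
  assumes "\<eta> \<in> test_functions \<Omega>"
  obtains L where "\<And>x. \<bar>dir_deriv z \<eta> x\<bar> \<le> L"
proof -
  obtain B where B: "\<And>i x. \<bar>partial_deriv i \<eta> x\<bar> \<le> B i"
    using test_function_bounded[OF test_function_partial_deriv[OF assms]] by metis
  have "\<bar>dir_deriv z \<eta> x\<bar> \<le> (\<Sum>i\<in>UNIV. \<bar>z $ i\<bar> * B i)" for x
    unfolding dir_deriv_def
    by (rule order_trans[OF sum_abs]) (auto simp: abs_mult intro!: sum_mono mult_left_mono B)
  then show thesis by (rule that)
qed

lemma along_line_has_derivative:
  assumes "smooth \<eta>"
  shows "((\<lambda>t. \<eta> (y - t *\<^sub>R z)) has_real_derivative - dir_deriv z \<eta> (y - t *\<^sub>R z)) (at t)"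
proof -
  have "((\<lambda>t. y - t *\<^sub>R z) has_derivative (\<lambda>h. - (h *\<^sub>R z))) (at t)"
    by (auto intro!: derivative_eq_intros)
  from has_derivative_compose[OF this smooth_has_derivative[OF assms]]
  have "((\<lambda>t. \<eta> (y - t *\<^sub>R z)) has_derivative
      (\<lambda>h. \<Sum>i\<in>UNIV. (- (h *\<^sub>R z)) $ i * partial_deriv i \<eta> (y - t *\<^sub>R z))) (at t)" .
  moreover have "(\<lambda>h. \<Sum>i\<in>UNIV. (- (h *\<^sub>R z)) $ i * partial_deriv i \<eta> (y - t *\<^sub>R z))
      = (*) (- dir_deriv z \<eta> (y - t *\<^sub>R z))"
    by (simp add: fun_eq_iff dir_deriv_def sum_distrib_left sum_distrib_right sum_negf ac_simps)
  ultimately show ?thesis by (simp add: has_field_derivative_def)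
qed

lemma continuous_bounded_mult_integrable:
  fixes u g :: "real ^ 'n::finite \<Rightarrow> real"
  assumes u: "integrable lborel u" and g: "continuous_on UNIV g" "\<And>x. \<bar>g x\<bar> \<le> L"
  shows "integrable lborel (\<lambda>x. u x * g x)"
proof (rule Bochner_Integration.integrable_bound[of _ "\<lambda>x. L * u x"])
  show "integrable lborel (\<lambda>x. L * u x)" using u by simp
  have "u \<in> borel_measurable lborel" using u by auto
  moreover have "g \<in> borel_measurable lborel"
    using borel_measurable_continuous_onI[OF g(1)] by simp
  ultimately show "(\<lambda>x. u x * g x) \<in> borel_measurable lborel" by (rule borel_measurable_times)
  have "\<bar>g x\<bar> \<le> \<bar>L\<bar>" for x using g(2)[of x] by linarith
  then show "AE x in lborel. norm (u x * g x) \<le> norm (L * u x)"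
    by (auto simp: abs_mult mult.commute intro!: mult_right_mono)
qed

text \<open>
  The difference quotients of \<open>\<eta>\<close> are bounded by the maximum of its directional derivative, so
  dominated convergence applies although \<open>u\<close> is merely integrable.
\<close>

lemma integral_along_line_has_derivative:
  fixes u :: "real ^ 'n::finite \<Rightarrow> real"
  assumes u: "integrable lborel u"
    and \<eta>: "\<eta> \<in> test_functions \<Omega>"
  shows "((\<lambda>t. \<integral>y. u y * \<eta> (y - t *\<^sub>R z) \<partial>lborel) has_real_derivative
      - (\<integral>y. u y * dir_deriv z \<eta> (y - t *\<^sub>R z) \<partial>lborel)) (at t)"
proof -
  note s = test_function_smooth[OF \<eta>]
  obtain L where L: "\<And>x. \<bar>dir_deriv z \<eta> x\<bar> \<le> L"
    using dir_deriv_bounded[OF \<eta>] by blast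
  have c: "continuous_on UNIV (\<lambda>y. \<eta> (y - r *\<^sub>R z))" for r
    using smooth_imp_continuous[OF smooth_translate[OF s]] .
  have cd: "continuous_on UNIV (\<lambda>y. dir_deriv z \<eta> (y - r *\<^sub>R z))" for r
    by (rule continuous_on_compose2[OF dir_deriv_continuous[OF \<eta>, of UNIV]])
      (auto intro!: continuous_intros)
  have um: "u \<in> borel_measurable lborel" using u by auto
  obtain B where B: "\<And>x. \<bar>\<eta> x\<bar> \<le> B" using test_function_bounded[OF \<eta>] by blast
  have int: "integrable lborel (\<lambda>y. u y * \<eta> (y - r *\<^sub>R z))" for r
    by (rule continuous_bounded_mult_integrable[OF u c B])
  have lip: "\<bar>\<eta> (y - (t + h) *\<^sub>R z) - \<eta> (y - t *\<^sub>R z)\<bar> \<le> L * \<bar>h\<bar>" for y h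
    using field_differentiable_bound[of UNIV "\<lambda>t. \<eta> (y - t *\<^sub>R z)" "\<lambda>t. - dir_deriv z \<eta> (y - t *\<^sub>R z)" L t "t + h"]
      along_line_has_derivative[OF s] L by auto
  show ?thesis
    unfolding DERIV_def tendsto_at_iff_sequentially
  proof (intro allI impI)
    fix X :: "nat \<Rightarrow> real"
    assume X0: "\<forall>i. X i \<in> UNIV - {0}" and X: "X \<longlonglongrightarrow> 0"
    have "(\<lambda>n. \<integral>y. u y * ((\<eta> (y - (t + X n) *\<^sub>R z) - \<eta> (y - t *\<^sub>R z)) / X n) \<partial>lborel)
        \<longlonglongrightarrow> (\<integral>y. u y * - dir_deriv z \<eta> (y - t *\<^sub>R z) \<partial>lborel)"
    proof (rule integral_dominated_convergence[where w = "\<lambda>y. L * \<bar>u y\<bar>"])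
      show "integrable lborel (\<lambda>y. L * \<bar>u y\<bar>)" using u by simp
      show "(\<lambda>y. u y * - dir_deriv z \<eta> (y - t *\<^sub>R z)) \<in> borel_measurable lborel"
        using borel_measurable_continuous_onI[OF cd] um
        by (intro borel_measurable_times borel_measurable_uminus) auto
      show "(\<lambda>y. u y * ((\<eta> (y - (t + X n) *\<^sub>R z) - \<eta> (y - t *\<^sub>R z)) / X n)) \<in> borel_measurable lborel" for n
        using borel_measurable_continuous_onI[OF c] um
        by (intro borel_measurable_times borel_measurable_divide borel_measurable_diff) auto
      show "AE y in lborel. (\<lambda>n. u y * ((\<eta> (y - (t + X n) *\<^sub>R z) - \<eta> (y - t *\<^sub>R z)) / X n))
          \<longlonglongrightarrow> u y * - dir_deriv z \<eta> (y - t *\<^sub>R z)"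
      proof (intro AE_I2 tendsto_mult tendsto_const)
        fix y
        have "(\<lambda>h. (\<eta> (y - (t + h) *\<^sub>R z) - \<eta> (y - t *\<^sub>R z)) / h) \<midarrow>0\<rightarrow> - dir_deriv z \<eta> (y - t *\<^sub>R z)"
          using along_line_has_derivative[OF s, of y z t] unfolding DERIV_def .
        then show "(\<lambda>n. (\<eta> (y - (t + X n) *\<^sub>R z) - \<eta> (y - t *\<^sub>R z)) / X n)
            \<longlonglongrightarrow> - dir_deriv z \<eta> (y - t *\<^sub>R z)"
          using X X0 unfolding tendsto_at_iff_sequentially comp_def by blast
      qed
      show "AE y in lborel. norm (u y * ((\<eta> (y - (t + X n) *\<^sub>R z) - \<eta> (y - t *\<^sub>R z)) / X n)) \<le> L * \<bar>u y\<bar>" for n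
      proof (intro AE_I2)
        fix y
        have "\<bar>(\<eta> (y - (t + X n) *\<^sub>R z) - \<eta> (y - t *\<^sub>R z)) / X n\<bar> \<le> L"
          using lip[of y "X n"] X0 by (simp add: pos_divide_le_eq)
        then show "norm (u y * ((\<eta> (y - (t + X n) *\<^sub>R z) - \<eta> (y - t *\<^sub>R z)) / X n)) \<le> L * \<bar>u y\<bar>"
          unfolding real_norm_def abs_mult mult.commute[of L] by (rule mult_left_mono) simp
      qed
    qed
    moreover have "((\<integral>y. u y * \<eta> (y - (t + h) *\<^sub>R z) \<partial>lborel) - (\<integral>y. u y * \<eta> (y - t *\<^sub>R z) \<partial>lborel)) / h
        = (\<integral>y. u y * ((\<eta> (y - (t + h) *\<^sub>R z) - \<eta> (y - t *\<^sub>R z)) / h) \<partial>lborel)" for h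
    proof -
      have "(\<integral>y. u y * ((\<eta> (y - (t + h) *\<^sub>R z) - \<eta> (y - t *\<^sub>R z)) / h) \<partial>lborel)
         = (\<integral>y. (u y * \<eta> (y - (t + h) *\<^sub>R z) - u y * \<eta> (y - t *\<^sub>R z)) / h \<partial>lborel)"
        by (simp add: right_diff_distrib)
      also have "\<dots> = (\<integral>y. u y * \<eta> (y - (t + h) *\<^sub>R z) - u y * \<eta> (y - t *\<^sub>R z) \<partial>lborel) / h"
        by (rule integral_divide_zero)
      also have "(\<integral>y. u y * \<eta> (y - (t + h) *\<^sub>R z) - u y * \<eta> (y - t *\<^sub>R z) \<partial>lborel)
          = (\<integral>y. u y * \<eta> (y - (t + h) *\<^sub>R z) \<partial>lborel) - (\<integral>y. u y * \<eta> (y - t *\<^sub>R z) \<partial>lborel)"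
        by (rule Bochner_Integration.integral_diff[OF int int])
      finally show ?thesis by (rule sym)
    qed
    ultimately show "((\<lambda>h. ((\<integral>y. u y * \<eta> (y - (t + h) *\<^sub>R z) \<partial>lborel) - (\<integral>y. u y * \<eta> (y - t *\<^sub>R z) \<partial>lborel)) / h) \<circ> X)
        \<longlonglongrightarrow> - (\<integral>y. u y * dir_deriv z \<eta> (y - t *\<^sub>R z) \<partial>lborel)"
      by (simp only: comp_def mult_minus_right Bochner_Integration.integral_minus)
  qed
qed

text \<open>
  Translating \<open>\<eta>\<close> does not change its integral, so the derivative of the integral along the
  translation vanishes.
\<close>

lemma integral_partial_deriv_zero:
  fixes \<Omega> :: "(real ^ 'n::finite) set"
  assumes \<eta>: "\<eta> \<in> test_functions \<Omega>"
  shows "(\<integral>x. partial_deriv i \<eta> x \<partial>lborel) = 0"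
proof -
  obtain K where K: "compact K" "\<And>x. x \<notin> K \<Longrightarrow> \<eta> x = 0"
    using test_function_support[OF \<eta>] by blast
  obtain r where r: "K \<subseteq> ball 0 r" "r > 0"
    using bounded_subset_ballD[OF compact_imp_bounded[OF K(1)], of 0] by blast
  \<comment> \<open>The constant \<open>1\<close> is not integrable, but the translates by less than \<open>1\<close> do not notice the cut-off.\<close>
  define u :: "real ^ 'n \<Rightarrow> real" where "u = indicator (cball 0 (r + 1))"
  have u: "integrable lborel u"
    unfolding u_def using emeasure_bounded_finite[of "cball (0 :: real ^ 'n) (r + 1)"] by simp
  define z :: "real ^ 'n" where "z = axis i 1"
  have z: "dir_deriv z \<eta> = partial_deriv i \<eta>"
    unfolding z_def by (rule dir_deriv_axis)
  note m = test_function_borel[OF \<eta>]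
  have const: "(\<integral>y. u y * \<eta> (y - t *\<^sub>R z) \<partial>lborel) = (\<integral>y. \<eta> y \<partial>lborel)" if "\<bar>t\<bar> < 1" for t
  proof -
    have "u y * \<eta> (y - t *\<^sub>R z) = \<eta> (- (t *\<^sub>R z) + y)" for y
    proof (cases "y - t *\<^sub>R z \<in> K")
      case True
      then have "norm (y - t *\<^sub>R z) < r" using r by auto
      moreover have "norm (t *\<^sub>R z) < 1" using that by (simp add: z_def)
      moreover have "norm y \<le> norm (y - t *\<^sub>R z) + norm (t *\<^sub>R z)"
        by (metis diff_add_cancel norm_triangle_ineq)
      ultimately have "norm y \<le> r + 1" by linarith
      then show ?thesis by (simp add: u_def)
    next
      case False
      then show ?thesis using K(2)[of "y - t *\<^sub>R z"] by simp
    qed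
    then have "(\<integral>y. u y * \<eta> (y - t *\<^sub>R z) \<partial>lborel) = (\<integral>y. \<eta> (- (t *\<^sub>R z) + y) \<partial>lborel)"
      by (rule Bochner_Integration.integral_cong[OF refl])
    then show ?thesis using integral_lborel_translate[OF m, of "- (t *\<^sub>R z)"] by simp
  qed
  have "((\<lambda>t::real. (\<integral>y. \<eta> y \<partial>lborel)) has_real_derivative 0) (at 0)" by simp
  then have "((\<lambda>t. \<integral>y. u y * \<eta> (y - t *\<^sub>R z) \<partial>lborel) has_real_derivative 0) (at 0)"
    by (rule has_field_derivative_transform_within_open[where S = "{-1<..<1}"]) (auto simp: const)
  from DERIV_unique[OF integral_along_line_has_derivative[OF u \<eta>] this]
  have "(\<integral>y. u y * partial_deriv i \<eta> y \<partial>lborel) = 0" by (simp add: z)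
  moreover have "u y * partial_deriv i \<eta> y = partial_deriv i \<eta> y" for y
  proof (cases "y \<in> K")
    case True
    then show ?thesis using r by (force simp: u_def)
  next
    case False
    have "open (- K)" using compact_imp_closed[OF K(1)] by (simp add: open_Compl)
    then show ?thesis
      using False K(2) partial_deriv_outside[of "- K" y \<eta> i] by auto
  qed
  ultimately show ?thesis by simp
qed

lemma integral_partial_deriv_zero_on:
  fixes \<Omega> :: "(real ^ 'n::finite) set"
  assumes "\<eta> \<in> test_functions \<Omega>"
  shows "(\<integral>x. indicator \<Omega> x * partial_deriv i \<eta> x \<partial>lborel) = 0"
proof -
  obtain K where "K \<subseteq> \<Omega>" "\<And>x. x \<notin> K \<Longrightarrow> partial_deriv i \<eta> x = 0"
    using test_function_support[OF test_function_partial_deriv[OF assms]] by blast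
  then have "(\<integral>x. indicator \<Omega> x * partial_deriv i \<eta> x \<partial>lborel) = (\<integral>x. partial_deriv i \<eta> x \<partial>lborel)"
    by (intro Bochner_Integration.integral_cong) (auto split: split_indicator)
  then show ?thesis using integral_partial_deriv_zero[OF assms] by simp
qed

text \<open>
  Borel functions on the whole space allow translations and Fubini's theorem without restricting the
  measure. The values outside \<open>\<Omega>\<close> do not enter the relation, since test functions vanish there.
\<close>

definition borel_weak_gradient ::
    "(real ^ 'n::finite) set \<Rightarrow> (real ^ 'n \<Rightarrow> real) \<Rightarrow> (real ^ 'n \<Rightarrow> real ^ 'n) \<Rightarrow> bool" where
  "borel_weak_gradient \<Omega> u G \<longleftrightarrow> integrable lborel u \<and> integrable lborel G \<and>
     (\<forall>\<eta>\<in>test_functions \<Omega>. \<forall>i.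
        (\<integral>x. u x * partial_deriv i \<eta> x \<partial>lborel) = - (\<integral>x. G x $ i * \<eta> x \<partial>lborel))"

lemma vec_nth_integrable:
  fixes G :: "'a \<Rightarrow> real ^ 'n::finite"
  shows "integrable M G \<Longrightarrow> integrable M (\<lambda>x. G x $ i)"
  by (rule integrable_bounded_linear[OF bounded_linear_vec_nth])

text \<open>
  For a test function \<open>\<eta>\<close> on \<open>A\<close> with \<open>\<bar>\<eta>\<bar> \<le> 1\<close>, the translates \<open>\<eta> (\<cdot> - t z)\<close> with \<open>0 \<le> t \<le> 1\<close> are
  test functions on \<open>\<Omega>\<close>. Hence \<open>\<integral> u \<eta> (\<cdot> - t z)\<close> has the derivative \<open>\<integral> (z \<bullet> G) \<eta> (\<cdot> - t z)\<close>, which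
  is at most \<open>\<bar>z\<bar> \<integral> \<bar>G\<bar>\<close>. The mean value theorem on \<open>[0, 1]\<close> and duality give the claim.
\<close>

lemma translation_estimate:
  fixes u :: "real ^ 'n::finite \<Rightarrow> real"
  assumes w: "borel_weak_gradient \<Omega> u G" and A: "open A" "bounded A"
    and seg: "\<And>x t. x \<in> A \<Longrightarrow> 0 \<le> t \<Longrightarrow> t \<le> 1 \<Longrightarrow> x + t *\<^sub>R z \<in> \<Omega>"
  shows "(\<integral>x. indicator A x * \<bar>u (z + x) - u x\<bar> \<partial>lborel) \<le> norm z * (\<integral>x. norm (G x) \<partial>lborel)"
proof (rule L1_le_by_duality[OF A])
  have u: "integrable lborel u" and G: "integrable lborel G"
    using w by (auto simp: borel_weak_gradient_def)
  show "integrable lborel (\<lambda>x. u (z + x) - u x)"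
    by (intro Bochner_Integration.integrable_diff integrable_lborel_translate u)
  fix \<eta> assume \<eta>: "\<eta> \<in> test_functions A" and le: "\<And>x. \<bar>\<eta> x\<bar> \<le> 1"
  obtain K where K: "compact K" "K \<subseteq> A" "\<And>x. x \<notin> K \<Longrightarrow> \<eta> x = 0"
    using test_function_support[OF \<eta>] by blast
  note s = test_function_smooth[OF \<eta>]
  define g where "g t = (\<integral>y. u y * \<eta> (y - t *\<^sub>R z) \<partial>lborel)" for t
  have test: "(\<lambda>y. \<eta> (y - t *\<^sub>R z)) \<in> test_functions \<Omega>" if "0 \<le> t" "t \<le> 1" for t
  proof (rule test_functionI[where K = "(+) (t *\<^sub>R z) ` K"])
    show "(+) (t *\<^sub>R z) ` K \<subseteq> \<Omega>"
      using seg that K(2) by (auto simp: add.commute[of "t *\<^sub>R z"])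
    fix x assume "x \<notin> (+) (t *\<^sub>R z) ` K"
    then have "x - t *\<^sub>R z \<notin> K" by (metis add.commute diff_add_cancel image_eqI)
    then show "\<eta> (x - t *\<^sub>R z) = 0" by (rule K(3))
  qed (use s K(1) in \<open>auto intro: smooth_translate compact_translation\<close>)
  have der: "(g has_real_derivative - (\<integral>y. u y * dir_deriv z \<eta> (y - t *\<^sub>R z) \<partial>lborel)) (at t)" for t
    unfolding g_def by (rule integral_along_line_has_derivative[OF u \<eta>])
  have dle: "- (\<integral>y. u y * dir_deriv z \<eta> (y - t *\<^sub>R z) \<partial>lborel) \<le> norm z * (\<integral>x. norm (G x) \<partial>lborel)"
    if t: "0 \<le> t" "t \<le> 1" for t
  proof -
    let ?\<eta> = "\<lambda>y. \<eta> (y - t *\<^sub>R z)"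
    have pd: "partial_deriv i ?\<eta> y = partial_deriv i \<eta> (y - t *\<^sub>R z)" for i y
      by (rule partial_deriv_translate[OF s])
    have cs: "continuous_on UNIV ?\<eta>" by (rule smooth_imp_continuous[OF smooth_translate[OF s]])
    note tp = test_function_partial_deriv[OF test[OF t]]
    have i1: "integrable lborel (\<lambda>y. u y * partial_deriv i ?\<eta> y)" for i
    proof -
      obtain L where "\<And>x. \<bar>partial_deriv i ?\<eta> x\<bar> \<le> L" using test_function_bounded[OF tp] by blast
      then show ?thesis
        by (rule continuous_bounded_mult_integrable[OF u test_function_continuous[OF tp]])
    qed
    have i2: "integrable lborel (\<lambda>y. G y $ i * ?\<eta> y)" for i
      by (rule continuous_bounded_mult_integrable[OF vec_nth_integrable[OF G] cs]) (rule le)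
    have "(\<integral>y. u y * dir_deriv z \<eta> (y - t *\<^sub>R z) \<partial>lborel)
        = (\<integral>y. (\<Sum>i\<in>UNIV. z $ i * (u y * partial_deriv i ?\<eta> y)) \<partial>lborel)"
      by (simp add: dir_deriv_def pd sum_distrib_left algebra_simps)
    also have "\<dots> = (\<Sum>i\<in>UNIV. z $ i * (\<integral>y. u y * partial_deriv i ?\<eta> y \<partial>lborel))"
      using i1 by (simp add: Bochner_Integration.integral_sum)
    also have "\<dots> = (\<Sum>i\<in>UNIV. z $ i * - (\<integral>y. G y $ i * ?\<eta> y \<partial>lborel))"
      using w test[OF t] by (simp add: borel_weak_gradient_def)
    also have "\<dots> = - (\<Sum>i\<in>UNIV. z $ i * (\<integral>y. G y $ i * ?\<eta> y \<partial>lborel))"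
      by (simp add: sum_negf)
    also have "(\<Sum>i\<in>UNIV. z $ i * (\<integral>y. G y $ i * ?\<eta> y \<partial>lborel))
        = (\<integral>y. (\<Sum>i\<in>UNIV. z $ i * (G y $ i * ?\<eta> y)) \<partial>lborel)"
      using i2 by (simp add: Bochner_Integration.integral_sum)
    also have "\<dots> = (\<integral>y. (z \<bullet> G y) * ?\<eta> y \<partial>lborel)"
      by (simp add: inner_vec_def sum_distrib_right mult.assoc)
    finally have "- (\<integral>y. u y * dir_deriv z \<eta> (y - t *\<^sub>R z) \<partial>lborel) = (\<integral>y. (z \<bullet> G y) * ?\<eta> y \<partial>lborel)"
      by simp
    also have "\<dots> \<le> (\<integral>y. norm z * norm (G y) \<partial>lborel)"
    proof (rule integral_mono)
      show "integrable lborel (\<lambda>y. (z \<bullet> G y) * ?\<eta> y)"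
        by (rule continuous_bounded_mult_integrable[OF _ cs le]) (use G in auto)
      show "integrable lborel (\<lambda>y. norm z * norm (G y))" using G by auto
      fix y
      have "(z \<bullet> G y) * ?\<eta> y \<le> \<bar>z \<bullet> G y\<bar> * \<bar>?\<eta> y\<bar>" by (metis abs_ge_self abs_mult)
      also have "\<dots> \<le> \<bar>z \<bullet> G y\<bar> * 1" using le by (intro mult_left_mono) auto
      also have "\<dots> \<le> norm z * norm (G y)" using Cauchy_Schwarz_ineq2 by simp
      finally show "(z \<bullet> G y) * ?\<eta> y \<le> norm z * norm (G y)" .
    qed
    finally show ?thesis by simp
  qed
  obtain t where t: "0 < t" "t < 1"
    and eq: "g 1 - g 0 = (1 - 0) * - (\<integral>y. u y * dir_deriv z \<eta> (y - t *\<^sub>R z) \<partial>lborel)"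
    using MVT2[of 0 1 g, OF _ der] by auto
  have m[measurable]: "\<eta> \<in> borel_measurable borel" "u \<in> borel_measurable borel"
    using smooth_imp_continuous[OF s] u by (auto intro: borel_measurable_continuous_onI)
  have c: "continuous_on UNIV \<eta>" by (rule smooth_imp_continuous[OF s])
  have "(\<integral>x. (u (z + x) - u x) * \<eta> x \<partial>lborel) = (\<integral>x. u (z + x) * \<eta> x - u x * \<eta> x \<partial>lborel)"
    by (simp add: left_diff_distrib)
  also have "\<dots> = (\<integral>x. u (z + x) * \<eta> x \<partial>lborel) - (\<integral>x. u x * \<eta> x \<partial>lborel)"
    by (intro Bochner_Integration.integral_diff
        continuous_bounded_mult_integrable[OF _ c le] integrable_lborel_translate u)
  also have "(\<integral>x. u (z + x) * \<eta> x \<partial>lborel) = g 1"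
    using integral_lborel_translate[of "\<lambda>y. u y * \<eta> (y - z)" z] by (simp add: g_def)
  also have "(\<integral>x. u x * \<eta> x \<partial>lborel) = g 0" by (simp add: g_def)
  also have "g 1 - g 0 \<le> norm z * (\<integral>x. norm (G x) \<partial>lborel)"
    using eq dle[of t] t by simp
  finally show "(\<integral>x. (u (z + x) - u x) * \<eta> x \<partial>lborel) \<le> norm z * (\<integral>x. norm (G x) \<partial>lborel)" .
qed

section \<open>The Poincare inequality under the cone condition\<close>

definition L1_on :: "'a::euclidean_space set \<Rightarrow> ('a \<Rightarrow> real) \<Rightarrow> real" where
  "L1_on A u = (\<integral>x. indicator A x * \<bar>u x\<bar> \<partial>lborel)"

lemma L1_on_integrable:
  fixes u :: "'a::euclidean_space \<Rightarrow> real"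
  assumes "integrable lborel u" "A \<in> sets borel"
  shows "integrable lborel (\<lambda>x. indicator A x * \<bar>u x\<bar>)"
  using integrable_mult_indicator[of A lborel "\<lambda>x. \<bar>u x\<bar>"] assms by simp

lemma L1_on_nonneg: "0 \<le> L1_on A u"
  unfolding L1_on_def by (intro Bochner_Integration.integral_nonneg) auto

lemma L1_on_mono:
  assumes "integrable lborel u" "A \<in> sets borel" "B \<in> sets borel" "A \<subseteq> B"
  shows "L1_on A u \<le> L1_on B u"
  unfolding L1_on_def
  by (intro integral_mono L1_on_integrable assms) (use assms(4) in \<open>auto split: split_indicator\<close>)

lemma L1_on_Un:
  assumes "integrable lborel u" "A \<in> sets borel" "B \<in> sets borel"
  shows "L1_on (A \<union> B) u \<le> L1_on A u + L1_on B u"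
proof -
  have "L1_on (A \<union> B) u \<le> (\<integral>x. indicator A x * \<bar>u x\<bar> + indicator B x * \<bar>u x\<bar> \<partial>lborel)"
    unfolding L1_on_def
    by (intro integral_mono Bochner_Integration.integrable_add L1_on_integrable assms)
      (use assms in \<open>auto split: split_indicator\<close>)
  also have "\<dots> = L1_on A u + L1_on B u"
    unfolding L1_on_def by (intro Bochner_Integration.integral_add L1_on_integrable assms)
  finally show ?thesis .
qed

text \<open>
  The constant may depend on \<open>A\<close>, \<open>B\<close> and \<open>\<Omega>\<close>, but not on the function. The estimate is meant for a
  ball \<open>B\<close> and functions from which their mean over \<open>B\<close> has been subtracted. As a property of \<open>A\<close>,
  being controlled passes to Borel subsets, to finite unions, and to bounded open sets that a
  translation along segments in \<open>\<Omega>\<close> moves into a controlled set.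
\<close>

definition controlled :: "(real ^ 'n::finite) set \<Rightarrow> (real ^ 'n) set \<Rightarrow> (real ^ 'n) set \<Rightarrow> bool" where
  "controlled \<Omega> B A \<longleftrightarrow> A \<in> sets borel \<and> (\<exists>C\<ge>0. \<forall>u G. borel_weak_gradient \<Omega> u G \<longrightarrow>
     L1_on A u \<le> C * (L1_on B u + (\<integral>x. norm (G x) \<partial>lborel)))"

lemma controlled_self:
  fixes B :: "(real ^ 'n::finite) set"
  assumes "B \<in> sets borel" shows "controlled \<Omega> B B"
proof -
  have "L1_on B u \<le> 1 * (L1_on B u + (\<integral>x. norm (G x) \<partial>lborel))" for u and G :: "real ^ 'n \<Rightarrow> real ^ 'n"
    by simp
  then show ?thesis using assms zero_le_one unfolding controlled_def by blast
qed

lemma controlled_subset: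
  assumes "controlled \<Omega> B A'" "A \<subseteq> A'" "A \<in> sets borel"
  shows "controlled \<Omega> B A"
proof -
  obtain C where C: "C \<ge> 0" "\<And>u G. borel_weak_gradient \<Omega> u G \<Longrightarrow>
      L1_on A' u \<le> C * (L1_on B u + (\<integral>x. norm (G x) \<partial>lborel))" and A': "A' \<in> sets borel"
    using assms(1) unfolding controlled_def by blast
  have "L1_on A u \<le> C * (L1_on B u + (\<integral>x. norm (G x) \<partial>lborel))" if "borel_weak_gradient \<Omega> u G" for u G
  proof -
    have "integrable lborel u" using that by (simp add: borel_weak_gradient_def)
    then have "L1_on A u \<le> L1_on A' u" using A' assms by (intro L1_on_mono) auto
    then show ?thesis using C(2)[OF that] by linarith
  qed
  then show ?thesis using C(1) assms(3) unfolding controlled_def by blast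
qed

lemma controlled_Un:
  assumes "controlled \<Omega> B A" "controlled \<Omega> B A'"
  shows "controlled \<Omega> B (A \<union> A')"
proof -
  obtain C where C: "C \<ge> 0" "\<And>u G. borel_weak_gradient \<Omega> u G \<Longrightarrow>
      L1_on A u \<le> C * (L1_on B u + (\<integral>x. norm (G x) \<partial>lborel))" and A: "A \<in> sets borel"
    using assms(1) unfolding controlled_def by blast
  obtain C' where C': "C' \<ge> 0" "\<And>u G. borel_weak_gradient \<Omega> u G \<Longrightarrow>
      L1_on A' u \<le> C' * (L1_on B u + (\<integral>x. norm (G x) \<partial>lborel))" and A': "A' \<in> sets borel"
    using assms(2) unfolding controlled_def by blast
  have "L1_on (A \<union> A') u \<le> (C + C') * (L1_on B u + (\<integral>x. norm (G x) \<partial>lborel))"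
    if "borel_weak_gradient \<Omega> u G" for u G
  proof -
    have "integrable lborel u" using that by (simp add: borel_weak_gradient_def)
    then have "L1_on (A \<union> A') u \<le> L1_on A u + L1_on A' u" using A A' by (rule L1_on_Un)
    then show ?thesis using C(2)[OF that] C'(2)[OF that] by (simp add: distrib_right)
  qed
  moreover have "0 \<le> C + C'" "A \<union> A' \<in> sets borel" using C(1) C'(1) A A' by auto
  ultimately show ?thesis unfolding controlled_def by blast
qed

lemma controlled_UN:
  fixes B :: "(real ^ 'n::finite) set"
  assumes "finite I" "\<And>i. i \<in> I \<Longrightarrow> controlled \<Omega> B (A i)"
  shows "controlled \<Omega> B (\<Union>i\<in>I. A i)"
  using assms
proof (induction I)
  case empty
  have "L1_on {} u \<le> 0 * (L1_on B u + (\<integral>x. norm (G x) \<partial>lborel))" for u and G :: "real ^ 'n \<Rightarrow> real ^ 'n"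
    by (simp add: L1_on_def)
  then show ?case unfolding controlled_def by auto
qed (auto intro: controlled_Un)

text \<open>
  On \<open>A\<close>, \<open>\<bar>u x\<bar>\<close> is at most \<open>\<bar>u (z + x) - u x\<bar> + \<bar>u (z + x)\<bar>\<close>. The translation estimate bounds the
  first term, and the second one is a contribution from \<open>A'\<close>.
\<close>

lemma controlled_translate:
  assumes c: "controlled \<Omega> B A'" and A: "open A" "bounded A"
    and seg: "\<And>x t. x \<in> A \<Longrightarrow> 0 \<le> t \<Longrightarrow> t \<le> 1 \<Longrightarrow> x + t *\<^sub>R z \<in> \<Omega>"
    and im: "\<And>x. x \<in> A \<Longrightarrow> z + x \<in> A'"
  shows "controlled \<Omega> B A"
proof -
  obtain C where C: "C \<ge> 0" "\<And>u G. borel_weak_gradient \<Omega> u G \<Longrightarrow>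
      L1_on A' u \<le> C * (L1_on B u + (\<integral>x. norm (G x) \<partial>lborel))" and A': "A' \<in> sets borel"
    using c unfolding controlled_def by blast
  have Ab: "A \<in> sets borel" using A(1) by simp
  have "L1_on A u \<le> (C + norm z) * (L1_on B u + (\<integral>x. norm (G x) \<partial>lborel))"
    if w: "borel_weak_gradient \<Omega> u G" for u G
  proof -
    have u: "integrable lborel u" using w by (simp add: borel_weak_gradient_def)
    note [measurable] = borel_measurable_integrable[OF u] A'
    note ut = integrable_lborel_translate[OF u, of z]
    note it = integrable_lborel_translate[OF L1_on_integrable[OF u A'], of z]
    have id: "integrable lborel (\<lambda>x. indicator A x * \<bar>u (z + x) - u x\<bar>)"
      by (intro L1_on_integrable Bochner_Integration.integrable_diff ut u Ab)
    have "L1_on A u \<le> (\<integral>x. indicator A x * \<bar>u (z + x) - u x\<bar> + indicator A' (z + x) * \<bar>u (z + x)\<bar> \<partial>lborel)"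
      unfolding L1_on_def
      by (intro integral_mono Bochner_Integration.integrable_add L1_on_integrable u Ab id it)
        (use im in \<open>auto split: split_indicator\<close>)
    also have "\<dots> = (\<integral>x. indicator A x * \<bar>u (z + x) - u x\<bar> \<partial>lborel) + (\<integral>x. indicator A' (z + x) * \<bar>u (z + x)\<bar> \<partial>lborel)"
      by (rule Bochner_Integration.integral_add[OF id it])
    also have "(\<integral>x. indicator A' (z + x) * \<bar>u (z + x)\<bar> \<partial>lborel) = L1_on A' u"
      unfolding L1_on_def by (rule integral_lborel_translate) measurable
    also have "(\<integral>x. indicator A x * \<bar>u (z + x) - u x\<bar> \<partial>lborel) + L1_on A' u
        \<le> norm z * (\<integral>x. norm (G x) \<partial>lborel) + C * (L1_on B u + (\<integral>x. norm (G x) \<partial>lborel))"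
      using translation_estimate[OF w A seg] C(2)[OF w] by (intro add_mono) auto
    also have "\<dots> \<le> (C + norm z) * (L1_on B u + (\<integral>x. norm (G x) \<partial>lborel))"
      using L1_on_nonneg[of B u] by (simp add: algebra_simps)
    finally show ?thesis .
  qed
  moreover have "0 \<le> C + norm z" using C(1) by simp
  ultimately show ?thesis using Ab unfolding controlled_def by blast
qed

text \<open>
  Near any point of \<open>\<Omega>\<close> the property of having a controlled ball around it is passed on by a short
  translation; by connectedness it then spreads from \<open>x0\<close> to all of \<open>\<Omega>\<close>.
\<close>

lemma controlled_ball:
  assumes "open \<Omega>" "connected \<Omega>" "x0 \<in> \<Omega>" "0 < r0" "x \<in> \<Omega>"
  shows "\<exists>r>0. controlled \<Omega> (ball x0 r0) (ball x r)"
proof (rule connected_induction_simple[where P = "\<lambda>x. \<exists>r>0. controlled \<Omega> (ball x0 r0) (ball x r)",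
      OF assms(2,3,5)])
  show "\<exists>r>0. controlled \<Omega> (ball x0 r0) (ball x0 r)"
    using assms(4) controlled_self[of "ball x0 r0"] by auto
  fix a assume "a \<in> \<Omega>"
  then obtain e where e: "e > 0" "ball a e \<subseteq> \<Omega>" using assms(1) openE by blast
  show "\<exists>T. openin (top_of_set \<Omega>) T \<and> a \<in> T \<and>
      (\<forall>x\<in>T. \<forall>y\<in>T. (\<exists>r>0. controlled \<Omega> (ball x0 r0) (ball x r)) \<longrightarrow> (\<exists>r>0. controlled \<Omega> (ball x0 r0) (ball y r)))"
  proof (rule exI[of _ "ball a (e/2)"], intro conjI ballI impI)
    show "openin (top_of_set \<Omega>) (ball a (e/2))"
      using e ball_subset_ball_iff[of a "e/2" a e] by (intro open_subset) (auto simp: subset_iff)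
    show "a \<in> ball a (e/2)" using e by simp
    fix x y assume xy: "x \<in> ball a (e/2)" "y \<in> ball a (e/2)"
      and "\<exists>r>0. controlled \<Omega> (ball x0 r0) (ball x r)"
    then obtain r where r: "r > 0" "controlled \<Omega> (ball x0 r0) (ball x r)" by blast
    have "controlled \<Omega> (ball x0 r0) (ball y (min r (e/2)))"
    proof (rule controlled_translate[OF r(2), where z = "x - y"])
      fix p assume p: "p \<in> ball y (min r (e/2))"
      then have py: "norm (p - y) < r" "norm (p - y) < e/2" by (auto simp: dist_norm norm_minus_commute)
      then show "(x - y) + p \<in> ball x r" by (simp add: dist_norm norm_minus_commute algebra_simps)
      fix t :: real assume t: "0 \<le> t" "t \<le> 1"
      have "(1 - t) *\<^sub>R y + t *\<^sub>R x \<in> ball a (e/2)"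
        using convex_ball[of a "e/2"] xy t unfolding convex_alt by blast
      then have "norm ((1 - t) *\<^sub>R y + t *\<^sub>R x - a) < e/2" by (simp add: dist_norm norm_minus_commute)
      then have "norm ((p - y) + ((1 - t) *\<^sub>R y + t *\<^sub>R x - a)) < e"
        using py norm_triangle_ineq[of "p - y" "(1 - t) *\<^sub>R y + t *\<^sub>R x - a"] by linarith
      moreover have "(p - y) + ((1 - t) *\<^sub>R y + t *\<^sub>R x - a) = p + t *\<^sub>R (x - y) - a"
        by (simp add: algebra_simps)
      ultimately show "p + t *\<^sub>R (x - y) \<in> \<Omega>"
        using e(2) by (auto simp: dist_norm norm_minus_commute)
    qed auto
    then show "\<exists>r>0. controlled \<Omega> (ball x0 r0) (ball y r)"
      using r(1) e(1) by (intro exI[of _ "min r (e/2)"]) auto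
  qed
qed

lemma controlled_compact:
  assumes "open \<Omega>" "connected \<Omega>" "x0 \<in> \<Omega>" "0 < r0" "compact K" "K \<subseteq> \<Omega>"
  shows "\<exists>U. open U \<and> K \<subseteq> U \<and> controlled \<Omega> (ball x0 r0) U"
proof -
  have "\<forall>x\<in>K. \<exists>r>0. controlled \<Omega> (ball x0 r0) (ball x r)"
    using controlled_ball[OF assms(1-4)] assms(6) by blast
  then obtain r where r: "\<And>x. x \<in> K \<Longrightarrow> r x > 0 \<and> controlled \<Omega> (ball x0 r0) (ball x (r x))" by metis
  obtain D where D: "D \<subseteq> K" "finite D" "K \<subseteq> (\<Union>x\<in>D. ball x (r x))"
  proof (rule compactE_image[OF assms(5), of K "\<lambda>x. ball x (r x)"])
    show "K \<subseteq> (\<Union>x\<in>K. ball x (r x))" using r by force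
  qed auto
  have "controlled \<Omega> (ball x0 r0) (\<Union>x\<in>D. ball x (r x))"
    using D r by (intro controlled_UN) auto
  then show ?thesis using D(3) by (intro exI[of _ "\<Union>x\<in>D. ball x (r x)"]) auto
qed

text \<open>
  With \<open>c\<close> the mean of \<open>u\<close> over the ball \<open>B\<close>, \<open>\<bar>u y - c\<bar>\<close> is at most the mean of \<open>\<bar>u y - u x\<bar>\<close> over
  \<open>x\<close>. The substitution \<open>y = z + x\<close> turns the double integral of \<open>\<bar>u y - u x\<bar>\<close> over \<open>B \<times> B\<close> into an
  integral over \<open>z\<close> of differences of translates. Only \<open>\<bar>z\<bar> \<le> 2 r\<close> contributes, and for each such
  \<open>z\<close> the translation estimate applies because \<open>B\<close> is convex.
\<close>

lemma poincare_ball: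
  fixes x0 :: "real ^ 'n::finite"
  assumes r: "0 < r" "ball x0 r \<subseteq> \<Omega>"
  shows "\<exists>C\<ge>0. \<forall>u G. borel_weak_gradient \<Omega> u G \<longrightarrow>
    (\<exists>c. L1_on (ball x0 r) (\<lambda>x. u x - c) \<le> C * (\<integral>x. norm (G x) \<partial>lborel))"
proof -
  define B where "B = ball x0 r"
  define V where "V = measure lborel B"
  define W where "W = measure lborel (cball (0 :: real ^ 'n) (2 * r))"
  have V: "V > 0" unfolding V_def B_def using content_ball_pos[OF r(1)] .
  have Bm[measurable]: "B \<in> sets borel" by (simp add: B_def)
  have fB: "emeasure lborel B < \<infinity>" unfolding B_def by (rule emeasure_bounded_finite) simp
  have "\<exists>c. L1_on B (\<lambda>x. u x - c) \<le> (2 * r * W / V) * (\<integral>x. norm (G x) \<partial>lborel)"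
    if w: "borel_weak_gradient \<Omega> u G" for u G
  proof -
    define g where "g = (\<integral>x. norm (G x) \<partial>lborel)"
    have g: "g \<ge> 0" unfolding g_def by simp
    have u: "integrable lborel u" using w by (simp add: borel_weak_gradient_def)
    have um[measurable]: "u \<in> borel_measurable borel" using u by auto
    have iB: "integrable lborel (\<lambda>x. indicator B x * u x)"
      using integrable_mult_indicator[of B lborel u] u by simp
    have iI: "integrable lborel (indicator B :: _ \<Rightarrow> real)" using fB by simp
    define c where "c = (\<integral>x. indicator B x * u x \<partial>lborel) / V"
    let ?D = "\<lambda>x y. indicator B x * indicator B y * \<bar>u y - u x\<bar>"
    have slice: "(\<integral>\<^sup>+x. ennreal (?D x (z + x)) \<partial>lborel) \<le> ennreal (2 * r * g) * indicator (cball 0 (2 * r)) z" for z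
    proof (cases "z \<in> cball 0 (2 * r)")
      case True
      define A where "A = B \<inter> (\<lambda>x. z + x) -` B"
      have "open A" unfolding A_def B_def by (intro open_Int open_ball open_vimage continuous_intros)
      have "bounded A" unfolding A_def B_def by (intro bounded_Int) auto
      have seg: "x + t *\<^sub>R z \<in> \<Omega>" if "x \<in> A" "0 \<le> t" "t \<le> 1" for x t
      proof -
        have "(1 - t) *\<^sub>R x + t *\<^sub>R (z + x) \<in> B"
          using convex_ball[of x0 r] that unfolding convex_alt A_def B_def by blast
        then show ?thesis using r(2) by (auto simp: B_def algebra_simps)
      qed
      have Am: "A \<in> sets borel" using \<open>open A\<close> by simp
      have eq: "?D x (z + x) = indicator A x * \<bar>u (z + x) - u x\<bar>" for x
        by (auto simp: A_def split: split_indicator)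
      have "integrable lborel (\<lambda>x. indicator A x * \<bar>u (z + x) - u x\<bar>)"
        by (intro L1_on_integrable Bochner_Integration.integrable_diff integrable_lborel_translate u Am)
      then have "(\<integral>\<^sup>+x. ennreal (?D x (z + x)) \<partial>lborel) = ennreal (\<integral>x. indicator A x * \<bar>u (z + x) - u x\<bar> \<partial>lborel)"
        unfolding eq by (rule nn_integral_eq_integral) auto
      also have "\<dots> \<le> ennreal (norm z * g)"
        unfolding g_def by (intro ennreal_leI translation_estimate[OF w \<open>open A\<close> \<open>bounded A\<close> seg])
      also have "\<dots> \<le> ennreal (2 * r * g)"
        using True g by (intro ennreal_leI mult_right_mono) auto
      finally show ?thesis using True by simp
    next
      case False
      have "?D x (z + x) = 0" for x
      proof -
        have "\<not> (x \<in> B \<and> z + x \<in> B)"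
        proof
          assume "x \<in> B \<and> z + x \<in> B"
          then have "dist x0 x < r" "dist x0 (z + x) < r" by (auto simp: B_def)
          then have "dist (z + x) x < 2 * r" using dist_triangle2[of "z + x" x x0] by (simp add: dist_commute)
          then show False using False by (simp add: dist_norm)
        qed
        then show ?thesis by (auto split: split_indicator)
      qed
      then have "(\<integral>\<^sup>+x. ennreal (?D x (z + x)) \<partial>lborel) = 0" by (simp only: ennreal_0 nn_integral_const) simp
      then show ?thesis by simp
    qed
    have "ennreal V * (\<integral>\<^sup>+y. ennreal (indicator B y * \<bar>u y - c\<bar>) \<partial>lborel)
        = (\<integral>\<^sup>+y. ennreal V * ennreal (indicator B y * \<bar>u y - c\<bar>) \<partial>lborel)"
      by (rule nn_integral_cmult[symmetric]) measurable
    also have "\<dots> \<le> (\<integral>\<^sup>+y. (\<integral>\<^sup>+x. ennreal (?D x y) \<partial>lborel) \<partial>lborel)"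
    proof (rule nn_integral_mono)
      fix y
      show "ennreal V * ennreal (indicator B y * \<bar>u y - c\<bar>) \<le> (\<integral>\<^sup>+x. ennreal (?D x y) \<partial>lborel)"
      proof (cases "y \<in> B")
        case True
        have i: "integrable lborel (\<lambda>x. u y * indicator B x - indicator B x * u x)"
          using iB iI by simp
        have "(\<integral>x. u y * indicator B x - indicator B x * u x \<partial>lborel) = u y * V - c * V"
          using iB iI V by (simp add: Bochner_Integration.integral_diff V_def c_def)
        then have "V * \<bar>u y - c\<bar> = norm (\<integral>x. u y * indicator B x - indicator B x * u x \<partial>lborel)"
          using V by (simp add: abs_mult flip: left_diff_distrib)
        then have "ennreal V * ennreal \<bar>u y - c\<bar> = ennreal (norm (\<integral>x. u y * indicator B x - indicator B x * u x \<partial>lborel))"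
          using V by (simp flip: ennreal_mult)
        also have "\<dots> \<le> (\<integral>\<^sup>+x. norm (u y * indicator B x - indicator B x * u x) \<partial>lborel)"
          using integral_norm_bound_ennreal[OF i] .
        also have "\<dots> = (\<integral>\<^sup>+x. ennreal (?D x y) \<partial>lborel)"
          using True by (intro nn_integral_cong) (auto split: split_indicator)
        finally show ?thesis using True by simp
      qed simp
    qed
    also have "\<dots> = (\<integral>\<^sup>+x. (\<integral>\<^sup>+y. ennreal (?D x y) \<partial>lborel) \<partial>lborel)"
      by (rule lborel_pair.Fubini') measurable
    also have "\<dots> = (\<integral>\<^sup>+x. (\<integral>\<^sup>+z. ennreal (?D x (z + x)) \<partial>lborel) \<partial>lborel)"
    proof (rule nn_integral_cong)
      fix x
      have "(\<integral>\<^sup>+y. ennreal (?D x y) \<partial>lborel) = (\<integral>\<^sup>+y. ennreal (?D x y) \<partial>distr lborel borel ((+) x))"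
        by (simp add: lborel_distr_plus)
      also have "\<dots> = (\<integral>\<^sup>+z. ennreal (?D x (x + z)) \<partial>lborel)"
        by (rule nn_integral_distr) measurable
      finally show "(\<integral>\<^sup>+y. ennreal (?D x y) \<partial>lborel) = (\<integral>\<^sup>+z. ennreal (?D x (z + x)) \<partial>lborel)"
        by (simp add: add.commute)
    qed
    also have "\<dots> = (\<integral>\<^sup>+z. (\<integral>\<^sup>+x. ennreal (?D x (z + x)) \<partial>lborel) \<partial>lborel)"
      by (rule lborel_pair.Fubini') measurable
    also have "\<dots> \<le> (\<integral>\<^sup>+z. ennreal (2 * r * g) * indicator (cball (0 :: real ^ 'n) (2 * r)) z \<partial>lborel)"
      using slice by (intro nn_integral_mono) blast
    also have "\<dots> = ennreal (2 * r * g) * emeasure lborel (cball (0 :: real ^ 'n) (2 * r))"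
      by (rule nn_integral_cmult_indicator) simp
    also have "\<dots> = ennreal (2 * r * g * W)"
      using emeasure_bounded_finite[of "cball (0 :: real ^ 'n) (2 * r)"] r(1) g unfolding W_def
      by (subst emeasure_eq_ennreal_measure) (auto simp flip: ennreal_mult)
    finally have "ennreal V * (\<integral>\<^sup>+y. ennreal (indicator B y * \<bar>u y - c\<bar>) \<partial>lborel) \<le> ennreal (2 * r * g * W)" .
    moreover have "(\<integral>\<^sup>+y. ennreal (indicator B y * \<bar>u y - c\<bar>) \<partial>lborel) = ennreal (L1_on B (\<lambda>x. u x - c))"
    proof -
      have "integrable lborel (\<lambda>x. indicator B x * u x - c * indicator B x)"
        using iB iI by simp
      then have "integrable lborel (\<lambda>x. \<bar>indicator B x * u x - c * indicator B x\<bar>)" by simp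
      moreover have "\<bar>indicator B x * u x - c * indicator B x\<bar> = indicator B x * \<bar>u x - c\<bar>" for x
        by (auto split: split_indicator)
      ultimately have "integrable lborel (\<lambda>x. indicator B x * \<bar>u x - c\<bar>)" by simp
      then show ?thesis unfolding L1_on_def by (rule nn_integral_eq_integral) auto
    qed
    ultimately have "V * L1_on B (\<lambda>x. u x - c) \<le> 2 * r * g * W"
      using V r(1) g L1_on_nonneg[of B] by (simp add: W_def flip: ennreal_mult)
    then have "L1_on B (\<lambda>x. u x - c) \<le> (2 * r * W / V) * g"
      using V by (simp add: field_simps)
    then show ?thesis unfolding g_def by blast
  qed
  moreover have "0 \<le> 2 * r * W / V" using V r(1) by (simp add: W_def)
  ultimately show ?thesis unfolding B_def by blast
qed

lemma vec_angle_scaleR: "t > 0 \<Longrightarrow> vec_angle (t *\<^sub>R y) v = vec_angle y v"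
  by (simp add: vec_angle_def)

text \<open>
  The midpoint \<open>y0\<close> of the axis has a neighbourhood inside the cone, and with each of its points the
  cone contains the segment to the vertex. A direction from a finite \<open>\<delta>\<close>-net of the ball of radius
  \<open>\<rho>\<close> is close enough to the rotated midpoint \<open>R y0\<close> to serve in its place.
\<close>

lemma cone_condition_finite_directions:
  fixes \<Omega> :: "(real ^ 'n::finite) set"
  assumes "cone_condition \<Omega>"
  obtains W \<delta> where "finite W" "\<delta> > 0"
    "\<And>x. x \<in> \<Omega> \<Longrightarrow> \<exists>w\<in>W. (\<forall>t\<in>{0..1}. x + t *\<^sub>R w \<in> \<Omega>) \<and> ball (x + w) \<delta> \<subseteq> \<Omega>"
proof -
  obtain v :: "real ^ 'n" and \<rho> \<kappa> where v: "v \<noteq> 0" and \<rho>: "0 < \<rho>" and \<kappa>: "0 < \<kappa>"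
    and cone: "\<And>x. x \<in> \<Omega> \<Longrightarrow> \<exists>R. orthogonal_transformation R \<and> (\<lambda>y. x + R y) ` finite_cone v \<rho> \<kappa> \<subseteq> \<Omega>"
    using assms unfolding cone_condition_def by blast
  define y0 where "y0 = (\<rho> / (2 * norm v)) *\<^sub>R v"
  have y0: "norm y0 = \<rho> / 2" "y0 \<noteq> 0" using v \<rho> by (auto simp: y0_def)
  have a0: "vec_angle y0 v = 0"
    using v \<rho> by (simp add: y0_def vec_angle_scaleR) (simp add: vec_angle_def dot_square_norm power2_eq_square)
  have cont: "isCont (\<lambda>y. vec_angle y v) y0"
  proof -
    have "continuous_on (- {0}) (\<lambda>y. vec_angle y v)"
      unfolding vec_angle_def
    proof (intro continuous_on_arccos continuous_intros ballI)
      fix y assume y: "y \<in> - {0 :: real ^ 'n}"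
      show "- 1 \<le> y \<bullet> v / (norm y * norm v) \<and> y \<bullet> v / (norm y * norm v) \<le> 1"
        using Cauchy_Schwarz_ineq2[of y v] y v by (auto simp: field_simps abs_le_iff)
    qed (use v in auto)
    then show ?thesis using y0(2) continuous_on_eq_continuous_at[of "- {0}" "\<lambda>y. vec_angle y v"]
      by (simp add: open_Compl)
  qed
  have "\<forall>\<^sub>F y in at y0. vec_angle y v < \<kappa> / 2"
    using cont a0 \<kappa> unfolding isCont_def by (intro order_tendstoD(2)) auto
  then obtain d where d0: "d > 0" "\<And>y. y \<noteq> y0 \<Longrightarrow> dist y y0 < d \<Longrightarrow> vec_angle y v < \<kappa> / 2"
    unfolding eventually_at by blast
  have d: "vec_angle y v < \<kappa> / 2" if "dist y y0 < d" for y
    using d0 a0 \<kappa> that by (cases "y = y0") auto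
  \<comment> \<open>One \<open>\<delta>\<close> is spent on the net, the other remains as the radius of the ball; \<open>2 \<delta> \<le> \<rho> / 2\<close> keeps the height below \<open>\<rho>\<close>.\<close>
  define \<delta> where "\<delta> = min d (\<rho> / 2) / 2"
  have \<delta>: "\<delta> > 0" "2 * \<delta> \<le> d" "2 * \<delta> \<le> \<rho> / 2" using d0(1) \<rho> by (auto simp: \<delta>_def)
  have inc: "t *\<^sub>R y \<in> finite_cone v \<rho> \<kappa>" if y: "dist y y0 < 2 * \<delta>" and t: "0 \<le> t" "t \<le> 1" for y t
  proof (cases "t = 0")
    case False
    have "norm y \<le> \<rho>"
      using y y0(1) \<delta>(3) norm_triangle_ineq2[of y y0] by (simp add: dist_norm)
    then have "norm (t *\<^sub>R y) \<le> \<rho>" using t mult_mono[of t 1 "norm y" \<rho>] by simp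
    moreover have "vec_angle (t *\<^sub>R y) v \<le> \<kappa> / 2"
      using d[of y] y \<delta>(2) t False by (simp add: vec_angle_scaleR)
    ultimately show ?thesis by (simp add: finite_cone_def)
  qed (simp add: finite_cone_def)
  obtain W where W: "finite W" "cball (0 :: real ^ 'n) \<rho> \<subseteq> (\<Union>w\<in>W. ball w \<delta>)"
    using compact_eq_totally_bounded[of "cball (0 :: real ^ 'n) \<rho>"] \<delta>(1) by auto
  show thesis
  proof
    show "finite W" "\<delta> > 0" by fact+
    fix x assume x: "x \<in> \<Omega>"
    obtain R where R: "orthogonal_transformation R" and im: "(\<lambda>y. x + R y) ` finite_cone v \<rho> \<kappa> \<subseteq> \<Omega>"
      using cone[OF x] by blast
    have "norm (R y0) \<le> \<rho>" using R y0(1) \<rho> by (simp add: orthogonal_transformation_norm)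
    then obtain w where w: "w \<in> W" "dist w (R y0) < \<delta>" using W(2) by (force simp: dist_commute)
    have near: "x + t *\<^sub>R w' \<in> \<Omega>" if w': "dist w' (R y0) < 2 * \<delta>" and t: "0 \<le> t" "t \<le> 1" for w' t
    proof -
      obtain y where y: "w' = R y" using orthogonal_transformation_surj[OF R] by blast
      have "dist y y0 < 2 * \<delta>" using w' y R by (simp add: orthogonal_transformation_isometry)
      from inc[OF this t] have "x + R (t *\<^sub>R y) \<in> \<Omega>" using im by blast
      then show ?thesis using R y by (simp add: orthogonal_transformation_def linear_scale)
    qed
    show "\<exists>w\<in>W. (\<forall>t\<in>{0..1}. x + t *\<^sub>R w \<in> \<Omega>) \<and> ball (x + w) \<delta> \<subseteq> \<Omega>"
    proof (intro bexI[of _ w] conjI ballI subsetI)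
      show "w \<in> W" by fact
      fix t :: real assume "t \<in> {0..1}"
      then show "x + t *\<^sub>R w \<in> \<Omega>" using near[of w t] w(2) \<delta>(1) by auto
    next
      fix p assume p: "p \<in> ball (x + w) \<delta>"
      have "dist (p - x) w < \<delta>" using p by (simp add: dist_norm norm_minus_commute algebra_simps)
      then have "dist (p - x) (R y0) < 2 * \<delta>"
        using w(2) dist_triangle[of "p - x" "R y0" w] by linarith
      from near[OF this, of 1] show "p \<in> \<Omega>" by simp
    qed
  qed
qed

text \<open>
  The complement is the set of differences of the closed set \<open>- \<Omega>\<close> and a compact segment.
\<close>

lemma open_segments_inside:
  fixes \<Omega> :: "'a::euclidean_space set"
  assumes "open \<Omega>"
  shows "open {x. \<forall>t\<in>{0..1}. x + t *\<^sub>R w \<in> \<Omega>}"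
proof -
  have "closed (\<Union>x\<in>- \<Omega>. \<Union>y\<in>(\<lambda>t. t *\<^sub>R w) ` {0..1::real}. {x - y})"
    by (intro closed_compact_differences compact_continuous_image continuous_intros)
      (use assms in auto)
  moreover have "- {x. \<forall>t\<in>{0..1}. x + t *\<^sub>R w \<in> \<Omega>} = (\<Union>x\<in>- \<Omega>. \<Union>y\<in>(\<lambda>t. t *\<^sub>R w) ` {0..1::real}. {x - y})"
    (is "?L = ?R")
  proof (intro equalityI subsetI)
    fix x assume "x \<in> ?L"
    then obtain t :: real where "t \<in> {0..1}" "x + t *\<^sub>R w \<notin> \<Omega>" by auto
    then show "x \<in> ?R"
      by (intro UN_I[of "x + t *\<^sub>R w"] UN_I[of "t *\<^sub>R w"]) auto
  next
    fix x assume "x \<in> ?R"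
    then obtain p and t :: real where "p \<notin> \<Omega>" "t \<in> {0..1}" "x = p - t *\<^sub>R w" by auto
    then have "x + t *\<^sub>R w \<notin> \<Omega>" by simp
    with \<open>t \<in> {0..1}\<close> show "x \<in> ?L" by blast
  qed
  ultimately show ?thesis by (simp add: open_closed)
qed

text \<open>
  The points at distance at least \<open>\<delta>\<close> from the complement of \<open>\<Omega>\<close> form a compact set \<open>K\<close>, which has
  a controlled open neighbourhood \<open>U\<close>. By the cone condition, one of finitely many translations
  carries a given point of \<open>\<Omega>\<close> into \<open>U\<close> along a segment in \<open>\<Omega>\<close>.
\<close>

lemma controlled_cone_domain:
  fixes \<Omega> :: "(real ^ 'n::finite) set"
  assumes \<Omega>: "open \<Omega>" "connected \<Omega>" "bounded \<Omega>" "cone_condition \<Omega>" and x0: "x0 \<in> \<Omega>" "0 < r0"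
  shows "controlled \<Omega> (ball x0 r0) \<Omega>"
proof -
  obtain W \<delta> where W: "finite W" "\<delta> > 0"
    and dirs: "\<And>x. x \<in> \<Omega> \<Longrightarrow> \<exists>w\<in>W. (\<forall>t\<in>{0..1}. x + t *\<^sub>R w \<in> \<Omega>) \<and> ball (x + w) \<delta> \<subseteq> \<Omega>"
    using cone_condition_finite_directions[OF \<Omega>(4)] by blast
  define K where "K = {y. ball y \<delta> \<subseteq> \<Omega>}"
  have K: "K \<subseteq> \<Omega>" using W(2) by (auto simp: K_def)
  have "K = - (\<Union>p\<in>- \<Omega>. ball p \<delta>)" by (auto simp: K_def dist_commute)
  then have "closed K" by auto
  then have "compact K" using bounded_subset[OF \<Omega>(3) K] by (simp add: compact_eq_bounded_closed)
  then obtain U where U: "open U" "K \<subseteq> U" "controlled \<Omega> (ball x0 r0) U"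
    using controlled_compact[OF \<Omega>(1,2) x0 _ K] by blast
  define A where "A w = {x. \<forall>t\<in>{0..1}. x + t *\<^sub>R w \<in> \<Omega>} \<inter> (\<lambda>x. w + x) -` U" for w
  have sub: "A w \<subseteq> \<Omega>" for w
    unfolding A_def by (auto dest: bspec[of _ _ 0])
  have "controlled \<Omega> (ball x0 r0) (A w)" for w
  proof (rule controlled_translate[OF U(3), where z = w])
    show "open (A w)"
      unfolding A_def
      by (intro open_Int open_segments_inside \<Omega>(1) open_vimage U(1) continuous_intros)
    show "bounded (A w)" using bounded_subset[OF \<Omega>(3) sub] .
  qed (auto simp: A_def)
  then have "controlled \<Omega> (ball x0 r0) (\<Union>w\<in>W. A w)" using W(1) by (intro controlled_UN) auto
  moreover have "\<Omega> \<subseteq> (\<Union>w\<in>W. A w)"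
  proof
    fix x assume "x \<in> \<Omega>"
    then obtain w where w: "w \<in> W" "\<forall>t\<in>{0..1}. x + t *\<^sub>R w \<in> \<Omega>" and "x + w \<in> K"
      using dirs unfolding K_def by blast
    then have "w + x \<in> U" using U(2) by (metis add.commute subsetD)
    with w show "x \<in> (\<Union>w\<in>W. A w)" unfolding A_def by blast
  qed
  ultimately show ?thesis using \<Omega>(1) by (metis controlled_subset borel_open)
qed

text \<open>
  The constant \<open>c\<close> comes from a ball in \<open>\<Omega>\<close>. Subtracting it on \<open>\<Omega>\<close> keeps the weak gradient, and
  the ball controls \<open>\<Omega>\<close>.
\<close>

lemma poincare_cone_domain:
  fixes \<Omega> :: "(real ^ 'n::finite) set"
  assumes \<Omega>: "open \<Omega>" "connected \<Omega>" "\<Omega> \<noteq> {}" "bounded \<Omega>" "cone_condition \<Omega>"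
  shows "\<exists>C\<ge>0. \<forall>u G. borel_weak_gradient \<Omega> u G \<longrightarrow>
    (\<exists>c. L1_on \<Omega> (\<lambda>x. u x - c) \<le> C * (\<integral>x. norm (G x) \<partial>lborel))"
proof -
  obtain x0 where x0: "x0 \<in> \<Omega>" using \<Omega>(3) by blast
  then obtain r where r: "r > 0" "ball x0 r \<subseteq> \<Omega>" using \<Omega>(1) openE by blast
  obtain C1 where C1: "C1 \<ge> 0" "\<And>u G. borel_weak_gradient \<Omega> u G \<Longrightarrow>
      \<exists>c. L1_on (ball x0 r) (\<lambda>x. u x - c) \<le> C1 * (\<integral>x. norm (G x) \<partial>lborel)"
    using poincare_ball[OF r] by blast
  obtain C2 where C2: "C2 \<ge> 0" "\<And>u G. borel_weak_gradient \<Omega> u G \<Longrightarrow>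
      L1_on \<Omega> u \<le> C2 * (L1_on (ball x0 r) u + (\<integral>x. norm (G x) \<partial>lborel))"
    using controlled_cone_domain[OF \<Omega>(1,2,4,5) x0 r(1)] unfolding controlled_def by blast
  have "\<exists>c. L1_on \<Omega> (\<lambda>x. u x - c) \<le> (C2 * (C1 + 1)) * (\<integral>x. norm (G x) \<partial>lborel)"
    if w: "borel_weak_gradient \<Omega> u G" for u G
  proof -
    have u: "integrable lborel u" using w by (simp add: borel_weak_gradient_def)
    obtain c where c: "L1_on (ball x0 r) (\<lambda>x. u x - c) \<le> C1 * (\<integral>x. norm (G x) \<partial>lborel)"
      using C1(2)[OF w] by blast
    have iI: "integrable lborel (indicator \<Omega> :: _ \<Rightarrow> real)"
      using emeasure_bounded_finite[OF \<Omega>(4)] \<Omega>(1) by simp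
    define u' where "u' x = u x - c * indicator \<Omega> x" for x
    have u': "borel_weak_gradient \<Omega> u' G"
      unfolding borel_weak_gradient_def
    proof (intro conjI ballI allI)
      show "integrable lborel u'" unfolding u'_def[abs_def] using u iI by simp
      show "integrable lborel G" using w by (simp add: borel_weak_gradient_def)
      fix \<eta> i assume \<eta>: "\<eta> \<in> test_functions \<Omega>"
      note tp = test_function_partial_deriv[OF \<eta>]
      obtain L where L: "\<And>x. \<bar>partial_deriv i \<eta> x\<bar> \<le> L" using test_function_bounded[OF tp] by blast
      note int = continuous_bounded_mult_integrable[OF _ test_function_continuous[OF tp] L]
      have "(\<integral>x. u' x * partial_deriv i \<eta> x \<partial>lborel)
          = (\<integral>x. u x * partial_deriv i \<eta> x - c * (indicator \<Omega> x * partial_deriv i \<eta> x) \<partial>lborel)"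
        by (simp add: u'_def left_diff_distrib mult.assoc)
      also have "\<dots> = (\<integral>x. u x * partial_deriv i \<eta> x \<partial>lborel) - c * (\<integral>x. indicator \<Omega> x * partial_deriv i \<eta> x \<partial>lborel)"
        using int[OF u] int[OF iI] by (simp add: Bochner_Integration.integral_diff)
      also have "(\<integral>x. indicator \<Omega> x * partial_deriv i \<eta> x \<partial>lborel) = 0"
        by (rule integral_partial_deriv_zero_on[OF \<eta>])
      finally show "(\<integral>x. u' x * partial_deriv i \<eta> x \<partial>lborel) = - (\<integral>x. G x $ i * \<eta> x \<partial>lborel)"
        using w \<eta> by (simp add: borel_weak_gradient_def)
    qed
    have eq: "L1_on S u' = L1_on S (\<lambda>x. u x - c)" if "S \<subseteq> \<Omega>" for S
      unfolding L1_on_def using that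
      by (intro Bochner_Integration.integral_cong) (auto simp: u'_def split: split_indicator)
    have "L1_on \<Omega> (\<lambda>x. u x - c) \<le> C2 * (L1_on (ball x0 r) (\<lambda>x. u x - c) + (\<integral>x. norm (G x) \<partial>lborel))"
      using C2(2)[OF u'] eq[of \<Omega>] eq[OF r(2)] by simp
    also have "\<dots> \<le> C2 * (C1 * (\<integral>x. norm (G x) \<partial>lborel) + (\<integral>x. norm (G x) \<partial>lborel))"
      using c C2(1) by (intro mult_left_mono add_right_mono)
    finally show ?thesis by (auto simp: algebra_simps)
  qed
  moreover have "0 \<le> C2 * (C1 + 1)" using C1(1) C2(1) by simp
  ultimately show ?thesis by blast
qed

section \<open>Sobolev functions on the domain\<close>

lemma finite_measure_bounded_open:
  assumes "open \<Omega>" "bounded \<Omega>"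
  shows "finite_measure (lebesgue_on (\<Omega> :: 'a::euclidean_space set))"
  using assms by (intro finite_measure_lebesgue_on bounded_set_imp_lmeasurable) auto

lemma L2_inner_integrable:
  fixes f g :: "real ^ 'n::finite \<Rightarrow> 'b::euclidean_space"
  assumes "f \<in> L2 \<Omega>" "g \<in> L2 \<Omega>"
  shows "integrable (lebesgue_on \<Omega>) (\<lambda>x. f x \<bullet> g x)"
proof (rule Bochner_Integration.integrable_bound)
  show "integrable (lebesgue_on \<Omega>) (\<lambda>x. (norm (f x))\<^sup>2 + (norm (g x))\<^sup>2)"
    using assms by (auto simp: L2_def)
  show "(\<lambda>x. f x \<bullet> g x) \<in> borel_measurable (lebesgue_on \<Omega>)"
    using assms by (auto simp: L2_def intro: borel_measurable_inner)
  show "AE x in lebesgue_on \<Omega>. norm (f x \<bullet> g x) \<le> norm ((norm (f x))\<^sup>2 + (norm (g x))\<^sup>2)"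
  proof (rule AE_I2)
    fix x
    have "2 * (norm (f x) * norm (g x)) \<le> (norm (f x))\<^sup>2 + (norm (g x))\<^sup>2"
      using sum_squares_bound[of "norm (f x)" "norm (g x)"] by simp
    moreover have "\<bar>f x \<bullet> g x\<bar> \<le> norm (f x) * norm (g x)" by (rule Cauchy_Schwarz_ineq2)
    moreover have "0 \<le> norm (f x) * norm (g x)" by simp
    ultimately show "norm (f x \<bullet> g x) \<le> norm ((norm (f x))\<^sup>2 + (norm (g x))\<^sup>2)"
      unfolding real_norm_def by linarith
  qed
qed

lemma L2_const:
  assumes "open \<Omega>" "bounded \<Omega>" shows "(\<lambda>x. c) \<in> L2 \<Omega>"
  using finite_measure.integrable_const[OF finite_measure_bounded_open[OF assms]]
  by (auto simp: L2_def)

text \<open>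
  The explicit bound comes from \<open>t \<le> 1 + t\<^sup>2\<close>.
\<close>

lemma L2_norm_integrable:
  fixes f :: "real ^ 'n::finite \<Rightarrow> 'b::euclidean_space"
  assumes "open \<Omega>" "bounded \<Omega>" "f \<in> L2 \<Omega>"
  shows "integrable (lebesgue_on \<Omega>) (\<lambda>x. norm (f x))"
    and "(\<integral>x. norm (f x) \<partial>lebesgue_on \<Omega>) \<le> measure lebesgue \<Omega> + L2_inner \<Omega> f f"
proof -
  interpret finite_measure "lebesgue_on \<Omega>" by (rule finite_measure_bounded_open[OF assms(1,2)])
  have le: "norm (f x) \<le> 1 + f x \<bullet> f x" for x
  proof -
    have "2 * norm (f x) \<le> 1 + (norm (f x))\<^sup>2"
      using sum_squares_bound[of 1 "norm (f x)"] by simp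
    then show ?thesis using norm_ge_zero[of "f x"] unfolding dot_square_norm by linarith
  qed
  have i: "integrable (lebesgue_on \<Omega>) (\<lambda>x. 1 + f x \<bullet> f x)"
    using L2_inner_integrable[OF assms(3,3)] by (intro Bochner_Integration.integrable_add) auto
  show j: "integrable (lebesgue_on \<Omega>) (\<lambda>x. norm (f x))"
  proof (rule Bochner_Integration.integrable_bound[OF i])
    show "(\<lambda>x. norm (f x)) \<in> borel_measurable (lebesgue_on \<Omega>)"
      using assms(3) by (auto simp: L2_def)
  qed (use le in \<open>auto intro!: AE_I2 order_trans[OF _ abs_ge_self]\<close>)
  have "(\<integral>x. norm (f x) \<partial>lebesgue_on \<Omega>) \<le> (\<integral>x. 1 + f x \<bullet> f x \<partial>lebesgue_on \<Omega>)"
    by (rule integral_mono[OF j i le])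
  also have "\<dots> = measure (lebesgue_on \<Omega>) (space (lebesgue_on \<Omega>)) + L2_inner \<Omega> f f"
    unfolding L2_inner_def using L2_inner_integrable[OF assms(3,3)]
    by (subst Bochner_Integration.integral_add) auto
  also have "measure (lebesgue_on \<Omega>) (space (lebesgue_on \<Omega>)) = measure lebesgue \<Omega>"
    using assms(1) by (simp add: measure_restrict_space)
  finally show "(\<integral>x. norm (f x) \<partial>lebesgue_on \<Omega>) \<le> measure lebesgue \<Omega> + L2_inner \<Omega> f f" .
qed

lemma L2_integrable:
  fixes f :: "real ^ 'n::finite \<Rightarrow> 'b::euclidean_space"
  assumes "open \<Omega>" "bounded \<Omega>" "f \<in> L2 \<Omega>"
  shows "integrable (lebesgue_on \<Omega>) f"
  using L2_norm_integrable(1)[OF assms] assms(3)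
  by (simp add: L2_def integrable_norm_iff)

lemma AE_lebesgue_on_iff:
  assumes "\<Omega> \<in> sets lebesgue"
  shows "(AE x in lebesgue_on \<Omega>. P x) \<longleftrightarrow> (AE x in lebesgue. x \<in> \<Omega> \<longrightarrow> P x)"
  using assms by (simp add: AE_restrict_space_iff)

text \<open>
  Functions on the domain are measurable only for the completed measure; this passes to Borel
  functions, for which the estimates above are stated.
\<close>

lemma borel_representative:
  fixes f :: "real ^ 'n::finite \<Rightarrow> real"
  assumes "open \<Omega>" "integrable (lebesgue_on \<Omega>) f"
  obtains f0 where "integrable lborel f0" "AE x in lebesgue. f0 x = indicator \<Omega> x * f x"
proof -
  have i: "integrable lebesgue (\<lambda>x. indicator \<Omega> x * f x)"
    using assms by (simp add: integrable_restrict_space)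
  obtain f0 where f0: "f0 \<in> borel_measurable lborel" "AE x in lborel. indicator \<Omega> x * f x = f0 x"
    using completion_ex_borel_measurable_real[OF borel_measurable_integrable[OF i]] by blast
  then have ae: "AE x in lebesgue. indicator \<Omega> x * f x = f0 x" by (simp add: AE_completion_iff)
  have "integrable lebesgue f0"
    by (rule integrable_cong_AE_imp[OF i _ ae]) (use f0 in \<open>auto intro: measurable_completion\<close>)
  then have "integrable lborel f0" using f0(1) by (simp add: integrable_completion)
  moreover have "AE x in lebesgue. f0 x = indicator \<Omega> x * f x" using ae by eventually_elim simp
  ultimately show thesis by (rule that)
qed

lemma integral_lebesgue_on_borel:
  fixes f :: "real ^ 'n::finite \<Rightarrow> real"
  assumes "open \<Omega>" "f \<in> borel_measurable borel"
  shows "(\<integral>x. f x \<partial>lebesgue_on \<Omega>) = (\<integral>x. indicator \<Omega> x * f x \<partial>lborel)"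
proof -
  have [measurable]: "\<Omega> \<in> sets borel" "f \<in> borel_measurable borel" using assms by auto
  have "(\<integral>x. f x \<partial>lebesgue_on \<Omega>) = (\<integral>x. indicator \<Omega> x * f x \<partial>lebesgue)"
    using assms(1) by (simp add: integral_restrict_space)
  also have "\<dots> = (\<integral>x. indicator \<Omega> x * f x \<partial>lborel)"
    by (rule integral_completion) measurable
  finally show ?thesis .
qed

lemma integral_representative:
  fixes f f0 g :: "real ^ 'n::finite \<Rightarrow> real"
  assumes "open \<Omega>" "integrable (lebesgue_on \<Omega>) f" "integrable lborel f0"
    and ae: "AE x in lebesgue. f0 x = indicator \<Omega> x * f x" and g: "g \<in> borel_measurable borel"
  shows "(\<integral>x. f x * g x \<partial>lebesgue_on \<Omega>) = (\<integral>x. f0 x * g x \<partial>lborel)"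
proof -
  have [measurable]: "f0 \<in> borel_measurable borel" "g \<in> borel_measurable borel" using assms by auto
  have i: "integrable lebesgue (\<lambda>x. indicator \<Omega> x * f x)"
    using assms by (simp add: integrable_restrict_space)
  have gl: "g \<in> borel_measurable lebesgue" by (intro measurable_completion) measurable
  have fl: "f0 \<in> borel_measurable lebesgue" by (intro measurable_completion) measurable
  have "(\<integral>x. f x * g x \<partial>lebesgue_on \<Omega>) = (\<integral>x. (indicator \<Omega> x * f x) * g x \<partial>lebesgue)"
    using assms(1) by (simp add: integral_restrict_space mult.assoc)
  also have "\<dots> = (\<integral>x. f0 x * g x \<partial>lebesgue)"
  proof (rule integral_cong_AE)
    show "(\<lambda>x. indicator \<Omega> x * f x * g x) \<in> borel_measurable lebesgue"
      using borel_measurable_integrable[OF i] gl by (rule borel_measurable_times)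
    show "(\<lambda>x. f0 x * g x) \<in> borel_measurable lebesgue"
      using fl gl by (intro borel_measurable_times)
    show "AE x in lebesgue. indicator \<Omega> x * f x * g x = f0 x * g x"
      using ae by eventually_elim simp
  qed
  also have "\<dots> = (\<integral>x. f0 x * g x \<partial>lborel)"
    by (rule integral_completion) measurable
  finally show ?thesis .
qed

lemma H1_weak_gradient:
  assumes "u \<in> H1 \<Omega>"
  shows "weak_gradient \<Omega> u \<in> L2 \<Omega>" "is_weak_gradient \<Omega> u (weak_gradient \<Omega> u)"
proof -
  have "\<exists>G. G \<in> L2 \<Omega> \<and> is_weak_gradient \<Omega> u G" using assms by (auto simp: H1_def)
  from someI_ex[OF this] show "weak_gradient \<Omega> u \<in> L2 \<Omega>" "is_weak_gradient \<Omega> u (weak_gradient \<Omega> u)"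
    unfolding weak_gradient_def by auto
qed

lemma weak_gradient_representatives:
  fixes \<Omega> :: "(real ^ 'n::finite) set"
  assumes \<Omega>: "open \<Omega>" "bounded \<Omega>" and u: "u \<in> L2 \<Omega>" and G: "G \<in> L2 \<Omega>" and w: "is_weak_gradient \<Omega> u G"
  obtains u0 G0 where "borel_weak_gradient \<Omega> u0 G0"
    "AE x in lebesgue. u0 x = indicator \<Omega> x * u x" "AE x in lebesgue. G0 x = indicator \<Omega> x *\<^sub>R G x"
proof -
  note ui = L2_integrable[OF \<Omega> u] and Gi = vec_nth_integrable[OF L2_integrable[OF \<Omega> G]]
  obtain u0 where u0: "integrable lborel u0" "AE x in lebesgue. u0 x = indicator \<Omega> x * u x"
    using borel_representative[OF \<Omega>(1) ui] by blast
  have "\<exists>g. integrable lborel g \<and> (AE x in lebesgue. g x = indicator \<Omega> x * G x $ i)" for i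
    using borel_representative[OF \<Omega>(1) Gi[of i]] by blast
  then obtain g where g: "\<And>i. integrable lborel (g i)"
    "\<And>i. AE x in lebesgue. g i x = indicator \<Omega> x * G x $ i" by metis
  define G0 :: "real ^ 'n \<Rightarrow> real ^ 'n" where "G0 x = (\<Sum>i\<in>UNIV. g i x *\<^sub>R axis i 1)" for x
  have nth: "G0 x $ i = g i x" for x i
    by (simp add: G0_def axis_def if_distrib cong: if_cong)
  have iG0: "integrable lborel G0"
    unfolding G0_def[abs_def] using g(1) by auto
  have "borel_weak_gradient \<Omega> u0 G0"
    unfolding borel_weak_gradient_def
  proof (intro conjI ballI allI u0 iG0)
    fix \<eta> i assume \<eta>: "\<eta> \<in> test_functions \<Omega>"
    have "(\<integral>x. u x * partial_deriv i \<eta> x \<partial>lebesgue_on \<Omega>) = (\<integral>x. u0 x * partial_deriv i \<eta> x \<partial>lborel)"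
      by (rule integral_representative[OF \<Omega>(1) ui u0 test_function_borel[OF test_function_partial_deriv[OF \<eta>]]])
    moreover have "(\<integral>x. G x $ i * \<eta> x \<partial>lebesgue_on \<Omega>) = (\<integral>x. g i x * \<eta> x \<partial>lborel)"
      by (rule integral_representative[OF \<Omega>(1) Gi g test_function_borel[OF \<eta>]])
    ultimately show "(\<integral>x. u0 x * partial_deriv i \<eta> x \<partial>lborel) = - (\<integral>x. G0 x $ i * \<eta> x \<partial>lborel)"
      using w \<eta> unfolding is_weak_gradient_def by (simp add: nth)
  qed
  moreover have "AE x in lebesgue. \<forall>i. g i x = indicator \<Omega> x * G x $ i"
    using g(2) by (simp add: AE_all_countable)
  then have "AE x in lebesgue. G0 x = indicator \<Omega> x *\<^sub>R G x"
    by eventually_elim (simp add: vec_eq_iff nth)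
  ultimately show thesis using u0(2) that by blast
qed

lemma poincare_H1:
  fixes \<Omega> :: "(real ^ 'n::finite) set"
  assumes \<Omega>: "open \<Omega>" "connected \<Omega>" "\<Omega> \<noteq> {}" "bounded \<Omega>" "cone_condition \<Omega>"
  shows "\<exists>C\<ge>0. \<forall>u\<in>H1 \<Omega>. \<exists>c. (\<integral>x. \<bar>u x - c\<bar> \<partial>lebesgue_on \<Omega>)
    \<le> C * (\<integral>x. norm (weak_gradient \<Omega> u x) \<partial>lebesgue_on \<Omega>)"
proof -
  obtain C where C: "C \<ge> 0" "\<And>u G. borel_weak_gradient \<Omega> u G \<Longrightarrow>
      \<exists>c. L1_on \<Omega> (\<lambda>x. u x - c) \<le> C * (\<integral>x. norm (G x) \<partial>lborel)"
    using poincare_cone_domain[OF \<Omega>] by blast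
  have "\<exists>c. (\<integral>x. \<bar>u x - c\<bar> \<partial>lebesgue_on \<Omega>) \<le> C * (\<integral>x. norm (weak_gradient \<Omega> u x) \<partial>lebesgue_on \<Omega>)"
    if u: "u \<in> H1 \<Omega>" for u
  proof -
    define G where "G = weak_gradient \<Omega> u"
    have uL: "u \<in> L2 \<Omega>" using u by (simp add: H1_def)
    have GL: "G \<in> L2 \<Omega>" and w: "is_weak_gradient \<Omega> u G"
      using H1_weak_gradient[OF u] by (auto simp: G_def)
    obtain u0 G0 where b: "borel_weak_gradient \<Omega> u0 G0"
      and u0: "AE x in lebesgue. u0 x = indicator \<Omega> x * u x"
      and G0: "AE x in lebesgue. G0 x = indicator \<Omega> x *\<^sub>R G x"
      using weak_gradient_representatives[OF \<Omega>(1,4) uL GL w] by blast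
    obtain c where c: "L1_on \<Omega> (\<lambda>x. u0 x - c) \<le> C * (\<integral>x. norm (G0 x) \<partial>lborel)"
      using C(2)[OF b] by blast
    have [measurable]: "u0 \<in> borel_measurable borel" "G0 \<in> borel_measurable borel"
      using b by (auto simp: borel_weak_gradient_def)
    have um: "u \<in> borel_measurable (lebesgue_on \<Omega>)" "G \<in> borel_measurable (lebesgue_on \<Omega>)"
      using uL GL by (auto simp: L2_def)
    have u0m: "u0 \<in> borel_measurable (lebesgue_on \<Omega>)" "G0 \<in> borel_measurable (lebesgue_on \<Omega>)"
      by (intro measurable_restrict_space1 measurable_completion; measurable)+
    have "(\<integral>x. \<bar>u x - c\<bar> \<partial>lebesgue_on \<Omega>) = (\<integral>x. \<bar>u0 x - c\<bar> \<partial>lebesgue_on \<Omega>)"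
    proof (rule integral_cong_AE)
      show "AE x in lebesgue_on \<Omega>. \<bar>u x - c\<bar> = \<bar>u0 x - c\<bar>"
        using u0 \<Omega>(1) by (auto simp: AE_lebesgue_on_iff elim: eventually_mono)
    qed (use um u0m in measurable)
    also have "\<dots> = L1_on \<Omega> (\<lambda>x. u0 x - c)"
      unfolding L1_on_def by (rule integral_lebesgue_on_borel[OF \<Omega>(1)]) measurable
    also note c
    also have "(\<integral>x. norm (G0 x) \<partial>lborel) = (\<integral>x. norm (G0 x) \<partial>lebesgue)"
      by (rule integral_completion[symmetric]) measurable
    also have "\<dots> = (\<integral>x. indicator \<Omega> x * norm (G x) \<partial>lebesgue)"
    proof (rule integral_cong_AE)
      show "AE x in lebesgue. norm (G0 x) = indicator \<Omega> x * norm (G x)"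
        using G0 by eventually_elim simp
      show "(\<lambda>x. norm (G0 x)) \<in> borel_measurable lebesgue"
        by (intro measurable_completion) measurable
      have "integrable lebesgue (\<lambda>x. indicator \<Omega> x * norm (G x))"
        using L2_norm_integrable(1)[OF \<Omega>(1,4) GL] \<Omega>(1) by (simp add: integrable_restrict_space)
      then show "(\<lambda>x. indicator \<Omega> x * norm (G x)) \<in> borel_measurable lebesgue" by auto
    qed
    also have "\<dots> = (\<integral>x. norm (G x) \<partial>lebesgue_on \<Omega>)"
      using \<Omega>(1) by (simp add: integral_restrict_space)
    finally show ?thesis unfolding G_def by blast
  qed
  then show ?thesis using C(1) by blast
qed

lemma test_function_integral_partial_deriv:
  fixes \<Omega> :: "(real ^ 'n::finite) set"
  assumes "open \<Omega>" "\<eta> \<in> test_functions \<Omega>"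
  shows "(\<integral>x. partial_deriv i \<eta> x \<partial>lebesgue_on \<Omega>) = 0"
  using integral_lebesgue_on_borel[OF assms(1)
      test_function_borel[OF test_function_partial_deriv[OF assms(2), of i]]]
    integral_partial_deriv_zero_on[OF assms(2)] by simp

lemma const_H1:
  fixes \<Omega> :: "(real ^ 'n::finite) set"
  assumes "open \<Omega>" "bounded \<Omega>"
  shows "(\<lambda>x. c) \<in> H1 \<Omega>"
proof -
  have "is_weak_gradient \<Omega> (\<lambda>x. c) (\<lambda>x. 0)"
    using test_function_integral_partial_deriv[OF assms(1)] by (simp add: is_weak_gradient_def)
  moreover have "(\<lambda>x. c) \<in> L2 \<Omega>" "(\<lambda>x. 0 :: real ^ 'n) \<in> L2 \<Omega>"
    by (rule L2_const[OF assms])+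
  ultimately show ?thesis unfolding H1_def by blast
qed

text \<open>
  The integral of \<open>G\<^sub>i \<eta>\<close> vanishes for every test function \<open>\<eta>\<close>, so the \<open>L\<^sup>1\<close> norm of \<open>G\<^sub>i\<close> vanishes
  by duality. This applies to any weak gradient and therefore to the chosen one.
\<close>

lemma weak_gradient_AE_const:
  fixes \<Omega> :: "(real ^ 'n::finite) set"
  assumes \<Omega>: "open \<Omega>" "bounded \<Omega>" and u: "u \<in> H1 \<Omega>" "AE x in lebesgue_on \<Omega>. u x = c"
  shows "AE x in lebesgue_on \<Omega>. weak_gradient \<Omega> u x = 0"
proof -
  define G where "G = weak_gradient \<Omega> u"
  have uL: "u \<in> L2 \<Omega>" using u by (simp add: H1_def)
  have GL: "G \<in> L2 \<Omega>" and w: "is_weak_gradient \<Omega> u G"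
    using H1_weak_gradient[OF u(1)] by (auto simp: G_def)
  obtain u0 G0 where b: "borel_weak_gradient \<Omega> u0 G0"
    and u0: "AE x in lebesgue. u0 x = indicator \<Omega> x * u x"
    and G0: "AE x in lebesgue. G0 x = indicator \<Omega> x *\<^sub>R G x"
    using weak_gradient_representatives[OF \<Omega> uL GL w] by blast
  have iG0: "integrable lborel G0" using b by (simp add: borel_weak_gradient_def)
  have "AE x in lborel. indicator \<Omega> x * \<bar>G0 x $ i\<bar> = 0" for i
  proof -
    have z: "(\<integral>x. G0 x $ i * \<eta> x \<partial>lborel) \<le> 0" if \<eta>: "\<eta> \<in> test_functions \<Omega>" for \<eta>
    proof -
      note m = test_function_borel[OF test_function_partial_deriv[OF \<eta>, of i]]
      have ml: "partial_deriv i \<eta> \<in> borel_measurable (lebesgue_on \<Omega>)"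
        using m by (intro measurable_restrict_space1 measurable_completion) simp
      have "(\<integral>x. u0 x * partial_deriv i \<eta> x \<partial>lborel) = (\<integral>x. u x * partial_deriv i \<eta> x \<partial>lebesgue_on \<Omega>)"
        using integral_representative[OF \<Omega>(1) L2_integrable[OF \<Omega> uL] _ u0 m] b
        by (simp add: borel_weak_gradient_def)
      also have "\<dots> = (\<integral>x. c * partial_deriv i \<eta> x \<partial>lebesgue_on \<Omega>)"
      proof (rule integral_cong_AE)
        show "(\<lambda>x. u x * partial_deriv i \<eta> x) \<in> borel_measurable (lebesgue_on \<Omega>)"
          using uL ml by (intro borel_measurable_times) (auto simp: L2_def)
        show "(\<lambda>x. c * partial_deriv i \<eta> x) \<in> borel_measurable (lebesgue_on \<Omega>)"
          using ml by (intro borel_measurable_times) auto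
        show "AE x in lebesgue_on \<Omega>. u x * partial_deriv i \<eta> x = c * partial_deriv i \<eta> x"
          using u(2) by eventually_elim simp
      qed
      also have "\<dots> = 0"
        using test_function_integral_partial_deriv[OF \<Omega>(1) \<eta>] by simp
      finally show ?thesis using b \<eta> by (simp add: borel_weak_gradient_def)
    qed
    have "(\<integral>x. indicator \<Omega> x * \<bar>G0 x $ i\<bar> \<partial>lborel) \<le> 0"
      by (rule L1_le_by_duality[OF \<Omega> vec_nth_integrable[OF iG0]]) (rule z)
    moreover have "0 \<le> (\<integral>x. indicator \<Omega> x * \<bar>G0 x $ i\<bar> \<partial>lborel)"
      by (intro Bochner_Integration.integral_nonneg) auto
    ultimately have "(\<integral>x. indicator \<Omega> x * \<bar>G0 x $ i\<bar> \<partial>lborel) = 0" by linarith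
    then show ?thesis
      using integral_nonneg_eq_0_iff_AE[OF L1_on_integrable[OF vec_nth_integrable[OF iG0]], of \<Omega> i] \<Omega>(1)
      by auto
  qed
  then have "AE x in lborel. \<forall>i. indicator \<Omega> x * \<bar>G0 x $ i\<bar> = 0"
    unfolding AE_all_countable by blast
  then have "AE x in lebesgue. \<forall>i. indicator \<Omega> x * \<bar>G0 x $ i\<bar> = 0"
    by (rule AE_completion)
  with G0 have "AE x in lebesgue. x \<in> \<Omega> \<longrightarrow> G x = 0"
    by eventually_elim (auto simp: vec_eq_iff)
  then show ?thesis using \<Omega>(1) by (simp add: AE_lebesgue_on_iff G_def)
qed

lemma L2_inner_AE_zero:
  fixes f g :: "real ^ 'n::finite \<Rightarrow> 'b::euclidean_space"
  assumes "f \<in> L2 \<Omega>" "g \<in> L2 \<Omega>" "AE x in lebesgue_on \<Omega>. g x = 0"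
  shows "L2_inner \<Omega> f g = 0"
proof -
  have "L2_inner \<Omega> f g = (\<integral>x. 0 \<partial>lebesgue_on \<Omega>)"
    unfolding L2_inner_def
  proof (rule integral_cong_AE)
    show "AE x in lebesgue_on \<Omega>. f x \<bullet> g x = 0" using assms(3) by eventually_elim simp
  qed (use L2_inner_integrable[OF assms(1,2)] in auto)
  then show ?thesis by simp
qed

lemma L2_inner_commute: "L2_inner \<Omega> f g = L2_inner \<Omega> g f"
  unfolding L2_inner_def by (simp add: inner_commute)

lemma L2_inner_self_nonneg: "0 \<le> L2_inner \<Omega> f f"
  unfolding L2_inner_def by (intro Bochner_Integration.integral_nonneg) auto

lemma L2_inner_Young:
  fixes f g :: "real ^ 'n::finite \<Rightarrow> 'b::euclidean_space"
  assumes "f \<in> L2 \<Omega>" "g \<in> L2 \<Omega>" "a > 0"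
  shows "\<bar>L2_inner \<Omega> f g\<bar> \<le> a * L2_inner \<Omega> f f + L2_inner \<Omega> g g / (4 * a)"
proof -
  note I = L2_inner_integrable[OF assms(1,1)] L2_inner_integrable[OF assms(2,2)]
    L2_inner_integrable[OF assms(1,2)]
  have pt: "\<bar>f x \<bullet> g x\<bar> \<le> a * (f x \<bullet> f x) + (g x \<bullet> g x) / (4 * a)" for x
  proof -
    have "0 \<le> (2 * a * norm (f x) - norm (g x))\<^sup>2 / (4 * a)" using assms(3) by simp
    also have "\<dots> = a * (norm (f x))\<^sup>2 + (norm (g x))\<^sup>2 / (4 * a) - norm (f x) * norm (g x)"
      using assms(3) by (simp add: field_simps power2_eq_square)
    finally show ?thesis
      using Cauchy_Schwarz_ineq2[of "f x" "g x"] by (simp add: dot_square_norm)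
  qed
  have "\<bar>L2_inner \<Omega> f g\<bar> \<le> (\<integral>x. \<bar>f x \<bullet> g x\<bar> \<partial>lebesgue_on \<Omega>)"
    unfolding L2_inner_def by (rule integral_abs_bound)
  also have "\<dots> \<le> (\<integral>x. a * (f x \<bullet> f x) + (g x \<bullet> g x) / (4 * a) \<partial>lebesgue_on \<Omega>)"
    using I by (intro integral_mono pt) auto
  also have "\<dots> = a * L2_inner \<Omega> f f + L2_inner \<Omega> g g / (4 * a)"
    unfolding L2_inner_def using I by simp
  finally show ?thesis .
qed

section \<open>Estimates for the relaxed system\<close>

lemma abs_lam_le: "\<bar>lam p\<bar> \<le> \<bar>p\<bar>"
  by (auto simp: lam_def)

lemma lam_L2:
  assumes "u \<in> L2 \<Omega>" shows "(\<lambda>x. lam (u x)) \<in> L2 \<Omega>"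
proof -
  have [measurable]: "u \<in> borel_measurable (lebesgue_on \<Omega>)" and i: "integrable (lebesgue_on \<Omega>) (\<lambda>x. (norm (u x))\<^sup>2)"
    using assms by (auto simp: L2_def)
  have m: "(\<lambda>x. lam (u x)) \<in> borel_measurable (lebesgue_on \<Omega>)" unfolding lam_def by measurable
  have "integrable (lebesgue_on \<Omega>) (\<lambda>x. (norm (lam (u x)))\<^sup>2)"
  proof (rule Bochner_Integration.integrable_bound[OF i])
    show "(\<lambda>x. (norm (lam (u x)))\<^sup>2) \<in> borel_measurable (lebesgue_on \<Omega>)" using m by measurable
    show "AE x in lebesgue_on \<Omega>. norm ((norm (lam (u x)))\<^sup>2) \<le> norm ((norm (u x))\<^sup>2)"
      using abs_lam_le by (intro AE_I2) (simp add: power_mono abs_le_square_iff)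
  qed
  then show ?thesis using m by (simp add: L2_def)
qed

text \<open>
  If \<open>p > 1\<close>, then \<open>p - q\<close> is at least \<open>p - 1 = lam p\<close> and also at least \<open>1 - \<bar>q\<bar>\<close>; the case
  \<open>p < -1\<close> is symmetric.
\<close>

lemma lam_coercive:
  assumes "\<bar>q\<bar> \<le> 1"
  shows "lam p * lam p \<le> lam p * p - lam p * q"
    and "(1 - \<bar>q\<bar>) * \<bar>lam p\<bar> \<le> lam p * p - q * lam p"
proof -
  consider "p > 1" | "p < -1" | "\<bar>p\<bar> \<le> 1" by linarith
  then have "lam p * lam p \<le> lam p * p - lam p * q \<and> (1 - \<bar>q\<bar>) * \<bar>lam p\<bar> \<le> lam p * p - q * lam p"
  proof cases
    case 1
    then have l: "lam p = p - 1" by (simp add: lam_def)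
    have "(p - 1) * (p - 1) \<le> (p - 1) * (p - q)" "(p - 1) * (1 - \<bar>q\<bar>) \<le> (p - 1) * (p - q)"
      using 1 assms by (auto intro!: mult_left_mono)
    then show ?thesis using 1 by (simp add: l algebra_simps)
  next
    case 2
    then have l: "lam p = p + 1" by (simp add: lam_def)
    have "(- p - 1) * (- p - 1) \<le> (- p - 1) * (q - p)" "(- p - 1) * (1 - \<bar>q\<bar>) \<le> (- p - 1) * (q - p)"
      using 2 assms by (auto intro!: mult_left_mono)
    then show ?thesis using 2 by (simp add: l algebra_simps)
  next
    case 3
    then have "lam p = 0" by (auto simp: lam_def)
    then show ?thesis by simp
  qed
  then show "lam p * lam p \<le> lam p * p - lam p * q" "(1 - \<bar>q\<bar>) * \<bar>lam p\<bar> \<le> lam p * p - q * lam p"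
    by auto
qed

text \<open>
  The second equation tested with \<open>\<phi> - \<phi>prev\<close>, together with the first one tested with \<open>\<mu>\<close> and with
  \<open>\<phi>prev\<close>, gives
  \<open>\<epsilon> (P, P) + \<tau> (Q, Q) + s/\<epsilon> (\<lambda>, \<phi> - \<phi>prev) = \<epsilon> (P, R) - \<tau>/\<epsilon> (Q, R)\<close>, with \<open>P, Q, R\<close> the gradients
  of \<open>\<phi>, \<mu>, \<phi>prev\<close> and \<open>\<lambda>\<close> the function \<open>lam \<circ> \<phi>\<close>. Young's inequality absorbs \<open>P\<close> and half of the
  \<open>Q\<close> term.
\<close>

lemma energy_estimate:
  fixes \<Omega> :: "(real ^ 'n::finite) set"
  assumes \<epsilon>: "\<epsilon> > 0" and \<tau>: "\<tau> > 0" and pr: "\<phi>prev \<in> H1 \<Omega>"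
    and sol: "relaxed_CH_solution \<Omega> \<epsilon> \<tau> \<phi>prev s \<phi> \<mu>"
  shows "\<tau> / 2 * L2_inner \<Omega> (weak_gradient \<Omega> \<mu>) (weak_gradient \<Omega> \<mu>)
      + s / \<epsilon> * (L2_inner \<Omega> (\<lambda>x. lam (\<phi> x)) \<phi> - L2_inner \<Omega> (\<lambda>x. lam (\<phi> x)) \<phi>prev)
    \<le> (\<epsilon> / 4 + \<tau> / (2 * \<epsilon>\<^sup>2)) * L2_inner \<Omega> (weak_gradient \<Omega> \<phi>prev) (weak_gradient \<Omega> \<phi>prev)"
proof -
  let ?P = "weak_gradient \<Omega> \<phi>" and ?Q = "weak_gradient \<Omega> \<mu>" and ?R = "weak_gradient \<Omega> \<phi>prev"
  let ?i = "L2_inner \<Omega>"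
  have H: "\<phi> \<in> H1 \<Omega>" "\<mu> \<in> H1 \<Omega>" using sol by (auto simp: relaxed_CH_solution_def)
  have e1: "\<And>v. v \<in> H1 \<Omega> \<Longrightarrow> ?i \<phi> v + \<tau> * L2_inner \<Omega> ?Q (weak_gradient \<Omega> v) = ?i \<phi>prev v"
    and e2: "\<And>v. v \<in> H1 \<Omega> \<Longrightarrow> \<epsilon> * L2_inner \<Omega> ?P (weak_gradient \<Omega> v) + inverse \<epsilon> * ?i (\<lambda>x. s * lam (\<phi> x)) v
      - inverse \<epsilon> * ?i \<phi>prev v = ?i \<mu> v"
    using sol by (auto simp: relaxed_CH_solution_def)
  have sl: "?i (\<lambda>x. s * lam (\<phi> x)) v = s * ?i (\<lambda>x. lam (\<phi> x)) v" for v
    by (simp add: L2_inner_def mult.assoc)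
  note f1 = e1[OF H(2)] and f2 = e1[OF pr] and f3 = e2[OF H(1)] and f4 = e2[OF pr]
  have c: "?i \<phi> \<mu> = ?i \<mu> \<phi>" "?i \<phi>prev \<mu> = ?i \<mu> \<phi>prev" "?i \<phi>prev \<phi> = ?i \<phi> \<phi>prev"
    by (auto intro: L2_inner_commute)
  have gP: "?P \<in> L2 \<Omega>" and gQ: "?Q \<in> L2 \<Omega>" and gR: "?R \<in> L2 \<Omega>"
    using H pr by (auto intro: H1_weak_gradient)
  have y1: "L2_inner \<Omega> ?P ?R \<le> L2_inner \<Omega> ?P ?P + L2_inner \<Omega> ?R ?R / 4"
    using L2_inner_Young[OF gP gR, of 1] by simp
  have y2: "- L2_inner \<Omega> ?Q ?R \<le> \<epsilon> / 2 * L2_inner \<Omega> ?Q ?Q + L2_inner \<Omega> ?R ?R / (2 * \<epsilon>)"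
    using L2_inner_Young[OF gQ gR, of "\<epsilon> / 2"] \<epsilon> by simp
  have "\<epsilon> * L2_inner \<Omega> ?P ?P + \<tau> * L2_inner \<Omega> ?Q ?Q + s / \<epsilon> * (?i (\<lambda>x. lam (\<phi> x)) \<phi> - ?i (\<lambda>x. lam (\<phi> x)) \<phi>prev)
      = \<epsilon> * L2_inner \<Omega> ?P ?R + \<tau> / \<epsilon> * - L2_inner \<Omega> ?Q ?R"
  proof -
    have eq: "\<tau> * L2_inner \<Omega> ?Q ?R = ?i \<phi>prev \<phi>prev - ?i \<phi> \<phi>prev" using f2 by linarith
    have "\<tau> / \<epsilon> * L2_inner \<Omega> ?Q ?R = inverse \<epsilon> * (\<tau> * L2_inner \<Omega> ?Q ?R)"
      by (simp add: divide_inverse)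
    then have "\<tau> / \<epsilon> * L2_inner \<Omega> ?Q ?R = inverse \<epsilon> * ?i \<phi>prev \<phi>prev - inverse \<epsilon> * ?i \<phi> \<phi>prev"
      by (simp only: eq right_diff_distrib)
    moreover have "s / \<epsilon> * (?i (\<lambda>x. lam (\<phi> x)) \<phi> - ?i (\<lambda>x. lam (\<phi> x)) \<phi>prev)
       = inverse \<epsilon> * (s * ?i (\<lambda>x. lam (\<phi> x)) \<phi>) - inverse \<epsilon> * (s * ?i (\<lambda>x. lam (\<phi> x)) \<phi>prev)"
      by (simp add: divide_inverse algebra_simps)
    ultimately show ?thesis using f1 f3 f4 unfolding c sl by linarith
  qed
  also have "\<dots> \<le> \<epsilon> * (L2_inner \<Omega> ?P ?P + L2_inner \<Omega> ?R ?R / 4)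
      + \<tau> / \<epsilon> * (\<epsilon> / 2 * L2_inner \<Omega> ?Q ?Q + L2_inner \<Omega> ?R ?R / (2 * \<epsilon>))"
    using y1 y2 \<epsilon> \<tau> by (intro add_mono mult_left_mono) auto
  also have "\<dots> = \<epsilon> * L2_inner \<Omega> ?P ?P + \<tau> / 2 * L2_inner \<Omega> ?Q ?Q
      + (\<epsilon> / 4 + \<tau> / (2 * \<epsilon>\<^sup>2)) * L2_inner \<Omega> ?R ?R"
    using \<epsilon> by (simp add: field_simps power2_eq_square)
  finally show ?thesis by simp
qed

text \<open>
  The second equation is tested with \<open>\<phi> - m\<close>. The first equation, tested with \<open>\<mu>\<close>, replaces
  \<open>(\<mu>, \<phi>)\<close> by \<open>(\<mu>, \<phi>prev)\<close> up to a term of good sign, and tested with \<open>\<phi>prev\<close> it removes the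
  remaining dependence on \<open>\<phi>\<close> at the price of \<open>\<tau> (Q, R)\<close>, where \<open>Q, R\<close> are the gradients of \<open>\<mu>\<close> and
  \<open>\<phi>prev\<close>.
\<close>

lemma L1_bound_interior_mean:
  fixes \<Omega> :: "(real ^ 'n::finite) set"
  assumes \<Omega>: "open \<Omega>" "bounded \<Omega>" and \<epsilon>: "\<epsilon> > 0" and \<tau>: "\<tau> > 0"
    and pr: "\<phi>prev \<in> H1 \<Omega>" and le1: "AE x in lebesgue_on \<Omega>. \<bar>\<phi>prev x\<bar> \<le> 1"
    and s: "s > 0" and sol: "relaxed_CH_solution \<Omega> \<epsilon> \<tau> \<phi>prev s \<phi> \<mu>"
    and m: "L2_inner \<Omega> \<phi>prev (\<lambda>x. 1) = m * measure lebesgue \<Omega>" "\<bar>m\<bar> \<le> 1"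
    and Cp: "Cp \<ge> 0" "(\<integral>x. \<bar>\<mu> x - c\<bar> \<partial>lebesgue_on \<Omega>) \<le> Cp * (\<integral>x. norm (weak_gradient \<Omega> \<mu> x) \<partial>lebesgue_on \<Omega>)"
    and K: "L2_inner \<Omega> (weak_gradient \<Omega> \<mu>) (weak_gradient \<Omega> \<mu>) \<le> K"
  shows "s * (1 - \<bar>m\<bar>) * L1_norm \<Omega> (\<lambda>x. lam (\<phi> x))
    \<le> L2_inner \<Omega> \<phi>prev \<phi>prev - m * L2_inner \<Omega> \<phi>prev (\<lambda>x. 1)
      + \<tau> * (K + L2_inner \<Omega> (weak_gradient \<Omega> \<phi>prev) (weak_gradient \<Omega> \<phi>prev) / 4)
      + 2 * \<epsilon> * Cp * (measure lebesgue \<Omega> + K)"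
proof -
  let ?P = "weak_gradient \<Omega> \<phi>" and ?Q = "weak_gradient \<Omega> \<mu>" and ?R = "weak_gradient \<Omega> \<phi>prev"
  let ?i = "L2_inner \<Omega>" and ?l = "\<lambda>x. lam (\<phi> x)" and ?V = "measure lebesgue \<Omega>"
  have H: "\<phi> \<in> H1 \<Omega>" "\<mu> \<in> H1 \<Omega>" using sol by (auto simp: relaxed_CH_solution_def)
  have one: "(\<lambda>x. 1 :: real) \<in> H1 \<Omega>" by (rule const_H1[OF \<Omega>])
  have L: "\<phi> \<in> L2 \<Omega>" "\<mu> \<in> L2 \<Omega>" "\<phi>prev \<in> L2 \<Omega>" "?l \<in> L2 \<Omega>" "(\<lambda>x. 1 :: real) \<in> L2 \<Omega>"
    using H pr one by (auto simp: H1_def intro: lam_L2)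
  have e1: "\<And>v. v \<in> H1 \<Omega> \<Longrightarrow> ?i \<phi> v + \<tau> * L2_inner \<Omega> ?Q (weak_gradient \<Omega> v) = ?i \<phi>prev v"
    and e2: "\<And>v. v \<in> H1 \<Omega> \<Longrightarrow> \<epsilon> * L2_inner \<Omega> ?P (weak_gradient \<Omega> v) + inverse \<epsilon> * ?i (\<lambda>x. s * lam (\<phi> x)) v
      - inverse \<epsilon> * ?i \<phi>prev v = ?i \<mu> v"
    using sol by (auto simp: relaxed_CH_solution_def)
  have sl: "?i (\<lambda>x. s * lam (\<phi> x)) v = s * ?i ?l v" for v
    by (simp add: L2_inner_def mult.assoc)
  have gP: "?P \<in> L2 \<Omega>" and gQ: "?Q \<in> L2 \<Omega>" and gR: "?R \<in> L2 \<Omega>"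
    using H pr by (auto intro: H1_weak_gradient)
  have g1: "L2_inner \<Omega> ?P (weak_gradient \<Omega> (\<lambda>x. 1)) = 0"
    using L2_inner_AE_zero[OF gP H1_weak_gradient(1)[OF one] weak_gradient_AE_const[OF \<Omega> one]] by auto
  note f1 = e1[OF H(2)] and f2 = e1[OF pr] and f3 = e2[OF H(1)] and f5 = e2[OF one]
  have c1: "?i \<phi> \<mu> = ?i \<mu> \<phi>" "?i \<phi>prev \<mu> = ?i \<mu> \<phi>prev" "?i \<phi>prev \<phi> = ?i \<phi> \<phi>prev"
    by (auto intro: L2_inner_commute)
  have ii: "integrable (lebesgue_on \<Omega>) (\<lambda>x. f x * g x)" if "f \<in> L2 \<Omega>" "g \<in> L2 \<Omega>" for f g :: "real ^ 'n \<Rightarrow> real"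
    using L2_inner_integrable[OF that] by simp
  have i1: "integrable (lebesgue_on \<Omega>) f" if "f \<in> L2 \<Omega>" for f :: "real ^ 'n \<Rightarrow> real"
    using L2_integrable[OF \<Omega> that] .
  have V: "(\<integral>x. 1 \<partial>lebesgue_on \<Omega>) = ?V"
    using \<Omega>(1) by (simp add: measure_restrict_space)
  interpret finite_measure "lebesgue_on \<Omega>" by (rule finite_measure_bounded_open[OF \<Omega>])
  \<comment> \<open>\<open>\<phi>prev - m\<close> has mean zero, so any constant may be subtracted from \<open>\<mu>\<close>.\<close>
  have mu: "?i \<mu> \<phi>prev - m * ?i \<mu> (\<lambda>x. 1) \<le> 2 * (Cp * (?V + K))"
  proof -
    have "(\<integral>x. (\<mu> x - c) * (\<phi>prev x - m) \<partial>lebesgue_on \<Omega>)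
        = (\<integral>x. \<mu> x * \<phi>prev x - m * \<mu> x - (c * \<phi>prev x - c * m) \<partial>lebesgue_on \<Omega>)"
      by (simp add: algebra_simps)
    also have "\<dots> = ?i \<mu> \<phi>prev - m * ?i \<mu> (\<lambda>x. 1) - (c * ?i \<phi>prev (\<lambda>x. 1) - c * m * ?V)"
      unfolding L2_inner_def using ii[OF L(2,3)] i1[OF L(2)] i1[OF L(3)] V
      by (simp add: Bochner_Integration.integral_diff)
    finally have "?i \<mu> \<phi>prev - m * ?i \<mu> (\<lambda>x. 1) = (\<integral>x. (\<mu> x - c) * (\<phi>prev x - m) \<partial>lebesgue_on \<Omega>)"
      using m(1) by simp
    also have "\<dots> \<le> (\<integral>x. 2 * \<bar>\<mu> x - c\<bar> \<partial>lebesgue_on \<Omega>)"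
    proof (rule integral_mono_AE)
      have "(\<lambda>x. \<mu> x * \<phi>prev x - m * \<mu> x - (c * \<phi>prev x - c * m)) = (\<lambda>x. (\<mu> x - c) * (\<phi>prev x - m))"
        by (simp add: fun_eq_iff algebra_simps)
      moreover have "integrable (lebesgue_on \<Omega>) (\<lambda>x. \<mu> x * \<phi>prev x - m * \<mu> x - (c * \<phi>prev x - c * m))"
        using ii[OF L(2,3)] i1[OF L(2)] i1[OF L(3)] by auto
      ultimately show "integrable (lebesgue_on \<Omega>) (\<lambda>x. (\<mu> x - c) * (\<phi>prev x - m))" by simp
      show "integrable (lebesgue_on \<Omega>) (\<lambda>x. 2 * \<bar>\<mu> x - c\<bar>)" using i1[OF L(2)] by auto
      show "AE x in lebesgue_on \<Omega>. (\<mu> x - c) * (\<phi>prev x - m) \<le> 2 * \<bar>\<mu> x - c\<bar>"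
        using le1
      proof eventually_elim
        case (elim x)
        have "(\<mu> x - c) * (\<phi>prev x - m) \<le> \<bar>\<mu> x - c\<bar> * \<bar>\<phi>prev x - m\<bar>" by (metis abs_ge_self abs_mult)
        also have "\<dots> \<le> \<bar>\<mu> x - c\<bar> * 2" using elim m(2) by (intro mult_left_mono) auto
        finally show ?case by simp
      qed
    qed
    also have "\<dots> = 2 * (\<integral>x. \<bar>\<mu> x - c\<bar> \<partial>lebesgue_on \<Omega>)" by simp
    also have "(\<integral>x. \<bar>\<mu> x - c\<bar> \<partial>lebesgue_on \<Omega>) \<le> Cp * (?V + K)"
    proof -
      have "(\<integral>x. norm (?Q x) \<partial>lebesgue_on \<Omega>) \<le> ?V + K"
        using L2_norm_integrable(2)[OF \<Omega> gQ] K by linarith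
      then show ?thesis using Cp by (meson mult_left_mono order_trans)
    qed
    finally show ?thesis by simp
  qed
  have low: "(1 - \<bar>m\<bar>) * L1_norm \<Omega> ?l \<le> ?i ?l \<phi> - m * ?i ?l (\<lambda>x. 1)"
  proof -
    have "(1 - \<bar>m\<bar>) * L1_norm \<Omega> ?l = (\<integral>x. (1 - \<bar>m\<bar>) * \<bar>lam (\<phi> x)\<bar> \<partial>lebesgue_on \<Omega>)"
      by (simp add: L1_norm_def)
    also have "\<dots> \<le> (\<integral>x. lam (\<phi> x) * \<phi> x - m * lam (\<phi> x) \<partial>lebesgue_on \<Omega>)"
      using ii[OF L(4,1)] i1[OF L(4)] m(2) by (intro integral_mono lam_coercive) auto
    also have "\<dots> = ?i ?l \<phi> - m * ?i ?l (\<lambda>x. 1)"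
      unfolding L2_inner_def using ii[OF L(4,1)] i1[OF L(4)] by simp
    finally show ?thesis .
  qed
  have y: "- L2_inner \<Omega> ?Q ?R \<le> K + L2_inner \<Omega> ?R ?R / 4"
    using L2_inner_Young[OF gQ gR, of 1] K by simp
  have P0: "0 \<le> \<epsilon> * L2_inner \<Omega> ?P ?P" and Q0: "0 \<le> \<tau> * L2_inner \<Omega> ?Q ?Q"
    using \<epsilon> \<tau> by (auto intro!: mult_nonneg_nonneg L2_inner_self_nonneg)
  have scale: "a \<le> b + \<epsilon> * d" if "inverse \<epsilon> * a \<le> inverse \<epsilon> * b + d" for a b d
    using mult_left_mono[OF that, of \<epsilon>] \<epsilon> by (simp add: distrib_left flip: mult.assoc)
  have "m * ?i \<mu> (\<lambda>x. 1) = m * (inverse \<epsilon> * (s * ?i ?l (\<lambda>x. 1))) - m * (inverse \<epsilon> * ?i \<phi>prev (\<lambda>x. 1))"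
    using f5 g1 sl by (simp flip: right_diff_distrib)
  then have "inverse \<epsilon> * (s * (?i ?l \<phi> - m * ?i ?l (\<lambda>x. 1)))
      \<le> inverse \<epsilon> * (?i \<phi> \<phi>prev - m * ?i \<phi>prev (\<lambda>x. 1)) + 2 * (Cp * (?V + K))"
    using f1 f3 mu P0 Q0 unfolding c1 sl by (simp add: algebra_simps)
  from scale[OF this] have "s * (?i ?l \<phi> - m * ?i ?l (\<lambda>x. 1))
      \<le> ?i \<phi> \<phi>prev - m * ?i \<phi>prev (\<lambda>x. 1) + 2 * \<epsilon> * Cp * (?V + K)"
    by (simp add: mult_ac)
  also have "?i \<phi> \<phi>prev = ?i \<phi>prev \<phi>prev + \<tau> * - L2_inner \<Omega> ?Q ?R" using f2 by simp
  also have "\<tau> * - L2_inner \<Omega> ?Q ?R \<le> \<tau> * (K + L2_inner \<Omega> ?R ?R / 4)"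
    using y \<tau> by (intro mult_left_mono) auto
  finally have "s * (?i ?l \<phi> - m * ?i ?l (\<lambda>x. 1)) \<le> ?i \<phi>prev \<phi>prev - m * ?i \<phi>prev (\<lambda>x. 1)
      + \<tau> * (K + L2_inner \<Omega> ?R ?R / 4) + 2 * \<epsilon> * Cp * (?V + K)" by simp
  moreover have "s * (1 - \<bar>m\<bar>) * L1_norm \<Omega> ?l \<le> s * (?i ?l \<phi> - m * ?i ?l (\<lambda>x. 1))"
    using low s by (simp add: mult.assoc mult_left_mono)
  ultimately show ?thesis by linarith
qed

theorem theorem5:
  fixes \<Omega> :: "(real ^ 'n::finite) set"
    and \<epsilon> \<tau> :: real
    and \<phi>prev :: "real ^ 'n \<Rightarrow> real"
    and \<phi> \<mu> :: "real \<Rightarrow> real ^ 'n \<Rightarrow> real"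
  assumes "CARD('n) \<in> {2, 3}"
    and "open \<Omega>" "connected \<Omega>" "\<Omega> \<noteq> {}" "bounded \<Omega>" "cone_condition \<Omega>"
    and "\<epsilon> > 0" "\<tau> > 0"
    and "\<phi>prev \<in> H1 \<Omega>" "AE x in lebesgue_on \<Omega>. \<bar>\<phi>prev x\<bar> \<le> 1"
    and "\<And>s. s > 0 \<Longrightarrow> relaxed_CH_solution \<Omega> \<epsilon> \<tau> \<phi>prev s (\<phi> s) (\<mu> s)"
  shows "\<exists>C>0. \<exists>s0>0. \<forall>s\<ge>s0. L1_norm \<Omega> (\<lambda>x. lam (\<phi> s x)) \<le> C * inverse s"
proof -
  note \<Omega> = assms(2-6) and \<epsilon> = assms(7) and \<tau> = assms(8) and pr = assms(9) and le1 = assms(10) and sol = assms(11)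
  note \<Omega>b = assms(2,5)
  let ?i = "L2_inner \<Omega>" and ?V = "measure lebesgue \<Omega>"
  have prL: "\<phi>prev \<in> L2 \<Omega>" using pr by (simp add: H1_def)
  note pri = L2_integrable[OF \<Omega>b prL]
  interpret finite_measure "lebesgue_on \<Omega>" by (rule finite_measure_bounded_open[OF \<Omega>b])
  have V1: "(\<integral>x. 1 \<partial>lebesgue_on \<Omega>) = ?V"
    using \<Omega>(1) by (simp add: measure_restrict_space)
  have "\<not> negligible \<Omega>" using open_not_negligible \<Omega>(1,3) by blast
  then have V: "?V > 0"
    using bounded_set_imp_lmeasurable[of \<Omega>] \<Omega> by (simp add: negligible_iff_measure0 zero_less_measure_iff)
  define m where "m = ?i \<phi>prev (\<lambda>x. 1) / ?V"
  have mV: "?i \<phi>prev (\<lambda>x. 1) = m * ?V" using V by (simp add: m_def)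
  have ip: "?i \<phi>prev (\<lambda>x. 1) = (\<integral>x. \<phi>prev x \<partial>lebesgue_on \<Omega>)" by (simp add: L2_inner_def)
  have m1: "\<bar>m\<bar> \<le> 1"
  proof -
    have "\<bar>\<integral>x. \<phi>prev x \<partial>lebesgue_on \<Omega>\<bar> \<le> (\<integral>x. \<bar>\<phi>prev x\<bar> \<partial>lebesgue_on \<Omega>)" by (rule integral_abs_bound)
    also have "\<dots> \<le> (\<integral>x. 1 \<partial>lebesgue_on \<Omega>)"
      using pri le1 by (intro integral_mono_AE) auto
    finally show ?thesis unfolding m_def ip V1 using V by (simp add: abs_divide)
  qed
  define R2 where "R2 = L2_inner \<Omega> (weak_gradient \<Omega> \<phi>prev) (weak_gradient \<Omega> \<phi>prev)"
  have lamdiff: "?i (\<lambda>x. lam (\<phi> s x)) (\<lambda>x. lam (\<phi> s x))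
      \<le> ?i (\<lambda>x. lam (\<phi> s x)) (\<phi> s) - ?i (\<lambda>x. lam (\<phi> s x)) \<phi>prev" (is "?A \<le> ?B") if "s > 0" for s
  proof -
    have "\<phi> s \<in> L2 \<Omega>" using sol[OF that] by (simp add: relaxed_CH_solution_def H1_def)
    note L = this lam_L2[OF this]
    note I = L2_inner_integrable[OF L(2,2)] L2_inner_integrable[OF L(2,1)] L2_inner_integrable[OF L(2) prL]
    have "?A \<le> (\<integral>x. lam (\<phi> s x) * \<phi> s x - lam (\<phi> s x) * \<phi>prev x \<partial>lebesgue_on \<Omega>)"
      unfolding L2_inner_def
    proof (rule integral_mono_AE)
      show "AE x in lebesgue_on \<Omega>. lam (\<phi> s x) \<bullet> lam (\<phi> s x) \<le> lam (\<phi> s x) * \<phi> s x - lam (\<phi> s x) * \<phi>prev x"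
        using le1 by eventually_elim (simp add: lam_coercive(1))
    qed (use I in auto)
    also have "\<dots> = ?B" unfolding L2_inner_def using I by simp
    finally show ?thesis .
  qed
  show ?thesis
  proof (cases "\<bar>m\<bar> < 1")
    case True
    obtain Cp where Cp: "Cp \<ge> 0" "\<And>u. u \<in> H1 \<Omega> \<Longrightarrow> \<exists>c. (\<integral>x. \<bar>u x - c\<bar> \<partial>lebesgue_on \<Omega>)
        \<le> Cp * (\<integral>x. norm (weak_gradient \<Omega> u x) \<partial>lebesgue_on \<Omega>)"
      using poincare_H1[OF \<Omega>] by blast
    define K where "K = 2 / \<tau> * ((\<epsilon> / 4 + \<tau> / (2 * \<epsilon>\<^sup>2)) * R2)"
    define K' where "K' = ?i \<phi>prev \<phi>prev - m * ?i \<phi>prev (\<lambda>x. 1) + \<tau> * (K + R2 / 4) + 2 * \<epsilon> * Cp * (?V + K)"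
    have scale: "q \<le> 2 / \<tau> * e" if "\<tau> / 2 * q \<le> e" for q e
      using that \<tau> by (simp add: field_simps)
    have est: "s * (1 - \<bar>m\<bar>) * L1_norm \<Omega> (\<lambda>x. lam (\<phi> s x)) \<le> K'" if s: "s > 0" for s
    proof -
      have H: "\<mu> s \<in> H1 \<Omega>" using sol[OF s] by (simp add: relaxed_CH_solution_def)
      obtain c where c: "(\<integral>x. \<bar>\<mu> s x - c\<bar> \<partial>lebesgue_on \<Omega>)
          \<le> Cp * (\<integral>x. norm (weak_gradient \<Omega> (\<mu> s) x) \<partial>lebesgue_on \<Omega>)" using Cp(2)[OF H] by blast
      have "0 \<le> s / \<epsilon> * (?i (\<lambda>x. lam (\<phi> s x)) (\<phi> s) - ?i (\<lambda>x. lam (\<phi> s x)) \<phi>prev)"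
        using lamdiff[OF s] L2_inner_self_nonneg[of \<Omega> "\<lambda>x. lam (\<phi> s x)"] s \<epsilon>
        by (intro mult_nonneg_nonneg) auto
      then have "\<tau> / 2 * L2_inner \<Omega> (weak_gradient \<Omega> (\<mu> s)) (weak_gradient \<Omega> (\<mu> s))
          \<le> (\<epsilon> / 4 + \<tau> / (2 * \<epsilon>\<^sup>2)) * R2"
        using energy_estimate[OF \<epsilon> \<tau> pr sol[OF s]] unfolding R2_def by linarith
      then have "L2_inner \<Omega> (weak_gradient \<Omega> (\<mu> s)) (weak_gradient \<Omega> (\<mu> s)) \<le> K"
        unfolding K_def by (rule scale)
      from L1_bound_interior_mean[OF \<Omega>b \<epsilon> \<tau> pr le1 s sol[OF s] mV m1 Cp(1) c this]
      show ?thesis unfolding K'_def R2_def .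
    qed
    define C where "C = (\<bar>K'\<bar> + 1) / (1 - \<bar>m\<bar>)"
    have "C > 0" unfolding C_def using True by (intro divide_pos_pos) auto
    moreover have "L1_norm \<Omega> (\<lambda>x. lam (\<phi> s x)) \<le> C * inverse s" if "s \<ge> 1" for s
    proof -
      have "s * (1 - \<bar>m\<bar>) * L1_norm \<Omega> (\<lambda>x. lam (\<phi> s x)) \<le> \<bar>K'\<bar> + 1" using est[of s] that by linarith
      then show ?thesis using that True unfolding C_def by (simp add: field_simps)
    qed
    ultimately show ?thesis by (intro exI[of _ C] conjI exI[of _ 1]) auto
  next
    case False
    then have mm: "m * m = 1" using m1 by (auto simp: abs_if split: if_splits)
    \<comment> \<open>As \<open>m = 1\<close> or \<open>m = -1\<close>, the function \<open>1 - m \<phi>prev\<close> is nonnegative with integral \<open>0\<close>.\<close>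
    have nn: "AE x in lebesgue_on \<Omega>. 0 \<le> 1 - m * \<phi>prev x"
      using le1
    proof eventually_elim
      case (elim x)
      have "m * \<phi>prev x \<le> \<bar>m\<bar> * \<bar>\<phi>prev x\<bar>" by (metis abs_ge_self abs_mult)
      also have "\<dots> \<le> 1 * 1" using m1 elim by (intro mult_mono) auto
      finally show ?case by simp
    qed
    have "(\<integral>x. 1 - m * \<phi>prev x \<partial>lebesgue_on \<Omega>) = ?V - m * (m * ?V)"
      using pri V1 ip mV by simp
    also have "\<dots> = 0" using mm by (simp flip: mult.assoc)
    finally have "AE x in lebesgue_on \<Omega>. 1 - m * \<phi>prev x = 0"
      using integral_nonneg_eq_0_iff_AE[OF _ nn] pri by simp
    then have const: "AE x in lebesgue_on \<Omega>. \<phi>prev x = m"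
    proof eventually_elim
      case (elim x)
      then have "m * (m * \<phi>prev x) = m" by simp
      then show ?case using mm by (simp flip: mult.assoc)
    qed
    note gp = H1_weak_gradient(1)[OF pr]
    have R0: "R2 = 0"
      unfolding R2_def by (rule L2_inner_AE_zero[OF gp gp weak_gradient_AE_const[OF \<Omega>b pr const]])
    have "L1_norm \<Omega> (\<lambda>x. lam (\<phi> s x)) = 0" if s: "s > 0" for s
    proof -
      have "\<phi> s \<in> L2 \<Omega>" using sol[OF s] by (simp add: relaxed_CH_solution_def H1_def)
      note L = lam_L2[OF this]
      have "0 \<le> \<tau> / 2 * L2_inner \<Omega> (weak_gradient \<Omega> (\<mu> s)) (weak_gradient \<Omega> (\<mu> s))"
        using \<tau> L2_inner_self_nonneg by (intro mult_nonneg_nonneg) auto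
      then have "s / \<epsilon> * (?i (\<lambda>x. lam (\<phi> s x)) (\<phi> s) - ?i (\<lambda>x. lam (\<phi> s x)) \<phi>prev) \<le> 0"
        using energy_estimate[OF \<epsilon> \<tau> pr sol[OF s]] R0 unfolding R2_def by simp
      then have "?i (\<lambda>x. lam (\<phi> s x)) (\<phi> s) - ?i (\<lambda>x. lam (\<phi> s x)) \<phi>prev \<le> 0"
        using s \<epsilon> by (simp add: mult_le_0_iff divide_le_0_iff)
      then have "?i (\<lambda>x. lam (\<phi> s x)) (\<lambda>x. lam (\<phi> s x)) = 0"
        using lamdiff[OF s] L2_inner_self_nonneg[of \<Omega> "\<lambda>x. lam (\<phi> s x)"] by linarith
      then have "AE x in lebesgue_on \<Omega>. lam (\<phi> s x) * lam (\<phi> s x) = 0"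
        unfolding L2_inner_def using integral_nonneg_eq_0_iff_AE[OF L2_inner_integrable[OF L L]] by simp
      then have "AE x in lebesgue_on \<Omega>. \<bar>lam (\<phi> s x)\<bar> = 0" by eventually_elim simp
      then show ?thesis unfolding L1_norm_def by (rule integral_eq_zero_AE)
    qed
    then show ?thesis by (intro exI[of _ 1] conjI exI[of _ 1]) auto
  qed
qed

end
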